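(* Let $G$ be a finitely generated group. Suppose that there exist three maximal missing subspaces $W_1,W_2,W_3$ in $\operatorname{Hom}(G,\mathbb R)$. If $\{W_1,W_2,W_3\}$ is a redundant triple of subspaces (with respect to some inner product and orthonormal basis of $\operatorname{Hom}(G,\mathbb R)$), then $G$ is not (isomorphic to) a right-angled Artin group.
   Context: A right-angled Artin group is a group $A_\Gamma=\langle V(\Gamma)\mid [v,w] \text{ whenever } (v,w)\in E(\Gamma)\rangle$ for a finite simplicial graph $\Gamma$. For a finitely generated group $G$, let $S(G)=\{[\chi]\mid \chi\in\operatorname{Hom}(G,\mathbb R)\setminus\{0\}\}$, where $[\chi]$ is the class of $\chi$ up to multiplication by positive reals. For a finite generating set $\mathcal S$, the BNS-invariant $\Sigma^1(G)\subseteq S(G)$ is the set of $[\chi]$ such that the full subgraph of $\operatorname{Cay}(G,\mathcal S)$ spanned by $\{g\in G\mid\chi(g)\ge 0\}$ is connected (independent of $\mathcal S$). A linear subspace $W\subseteq\operatorname{Hom}(G,\mathbb R)$ is a missing subspace if $[\chi]\notin\Sigma^1(G)$ for every $\chi\in W\setminus\{0\}$; maximal missing subspaces are those maximal with respect to inclusion. Redundant triple: let $V$ be an $n$-dimensional real vector space with an inner product, an orthonormal basis $e_1,\dots,e_n$ and corresponding coordinates $y_1,\dots,y_n$ ($y_i(e_j)=\delta_{ij}$). Consider subspaces of the form $W_1=\{y_1=0,\ \sum_i\lambda^1_{ij}y_i=0 \text{ for } j=1,\dots,m_1\}$, $W_2=\{y_2=0,\ \sum_i\lambda^2_{ij}y_i=0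 \text{ for } j=1,\dots,m_2\}$, $W_3=\{y_1-y_2=0,\ \sum_i\lambda^3_{ij}y_i=0 \text{ for } j=1,\dots,m_3\}$, with $\lambda^k_{ij}\in\mathbb R$, $m_k\ge 0$ integers and $\dim W_k=n-(m_k+1)$ (equivalently, $e_1\in W_1^\perp$, $e_2\in W_2^\perp$, $e_1-e_2\in W_3^\perp$). Inside $W_1^\perp\oplus W_2^\perp\oplus W_3^\perp$ let $K_{12}=\{(u,-u,0)\mid u\in W_1^\perp\cap W_2^\perp\}$, $K_{23}=\{(0,u,-u)\mid u\in W_2^\perp\cap W_3^\perp\}$, $K_{13}=\{(u,0,-u)\mid u\in W_1^\perp\cap W_3^\perp\}$, and let $\xi=(-e_1,e_2,e_1-e_2)$. Then $\{W_1,W_2,W_3\}$ is a redundant triple of subspaces if $\xi\notin K_{12}+K_{23}+K_{13}$. *)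

theory Defs
  imports
    Complex_Main
    "HOL-Library.Function_Algebras"
    "HOL-Library.Product_Plus"
    "HOL-Algebra.Generated_Groups"
    "Graph_Theory.Digraph_Component"
begin

section \<open>Group presentations and right-angled Artin groups\<close>

text \<open>
  A word over \<open>X\<close> is a list of letters \<open>(x, b)\<close> with \<open>x \<in> X\<close>; the letter \<open>(x, True)\<close> stands for
  \<open>x\<close> and \<open>(x, False)\<close> for its inverse.
\<close>

type_synonym 'x word = "('x \<times> bool) list"

definition words :: "'x set \<Rightarrow> 'x word set" where
  "words X = lists (X \<times> UNIV)"

inductive_set pres_rel :: "'x set \<Rightarrow> 'x word set \<Rightarrow> ('x word \<times> 'x word) set"
  for X :: "'x set" and R :: "'x word set" where
  refl: "w \<in> words X \<Longrightarrow> (w, w) \<in> pres_rel X R"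
| sym: "(u, v) \<in> pres_rel X R \<Longrightarrow> (v, u) \<in> pres_rel X R"
| trans: "(u, v) \<in> pres_rel X R \<Longrightarrow> (v, w) \<in> pres_rel X R \<Longrightarrow> (u, w) \<in> pres_rel X R"
| cancel: "u \<in> words X \<Longrightarrow> v \<in> words X \<Longrightarrow> x \<in> X
    \<Longrightarrow> (u @ [(x, b), (x, \<not> b)] @ v, u @ v) \<in> pres_rel X R"
| relator: "u \<in> words X \<Longrightarrow> v \<in> words X \<Longrightarrow> r \<in> R \<Longrightarrow> r \<in> words X
    \<Longrightarrow> (u @ r @ v, u @ v) \<in> pres_rel X R"

definition presented_group :: "'x set \<Rightarrow> 'x word set \<Rightarrow> 'x word set monoid" where
  "presented_group X R =
    \<lparr> carrier = words X // pres_rel X R,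
      monoid.mult = (\<lambda>A B. \<Union>a\<in>A. \<Union>b\<in>B. pres_rel X R `` {a @ b}),
      one = pres_rel X R `` {[]} \<rparr>"

definition commutator_word :: "'x \<Rightarrow> 'x \<Rightarrow> 'x word" where
  "commutator_word v w = [(v, True), (w, True), (v, False), (w, False)]"

text \<open>
  A finite simplicial graph is a \<^locale>\<open>pair_graph\<close>: finite, loop-free, without multiple edges, and
  with a symmetric set of arcs.
\<close>

definition raag :: "'v pair_pre_digraph \<Rightarrow> 'v word set monoid" where
  "raag \<Gamma> = presented_group (pverts \<Gamma>) {commutator_word v w | v w. (v, w) \<in> parcs \<Gamma>}"

lemma words_append [simp]: "u @ v \<in> words X \<longleftrightarrow> u \<in> words X \<and> v \<in> words X"
  by (simp add: words_def)

lemma words_Nil [simp]: "[] \<in> words X"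
  by (simp add: words_def)

lemma pres_rel_words: "(u, v) \<in> pres_rel X R \<Longrightarrow> u \<in> words X \<and> v \<in> words X"
  by (induction rule: pres_rel.induct) (auto simp: words_def)

lemma equiv_pres_rel: "equiv (words X) (pres_rel X R)"
  by (intro equivI refl_onI symI transI)
    (auto dest: pres_rel_words intro: pres_rel.refl pres_rel.sym pres_rel.trans)

lemma pres_rel_appendL: "(u, v) \<in> pres_rel X R \<Longrightarrow> w \<in> words X \<Longrightarrow> (w @ u, w @ v) \<in> pres_rel X R"
proof (induction rule: pres_rel.induct)
  case (cancel u v x b)
  then show ?case using pres_rel.cancel[of "w @ u" X v x b R] by simp
next
  case (relator u v r)
  then show ?case using pres_rel.relator[of "w @ u" X v r R] by simp
qed (auto intro: pres_rel.refl pres_rel.sym pres_rel.trans)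

lemma pres_rel_appendR: "(u, v) \<in> pres_rel X R \<Longrightarrow> w \<in> words X \<Longrightarrow> (u @ w, v @ w) \<in> pres_rel X R"
proof (induction rule: pres_rel.induct)
  case (cancel u v x b)
  then show ?case using pres_rel.cancel[of u X "v @ w" x b R] by simp
next
  case (relator u v r)
  then show ?case using pres_rel.relator[of u X "v @ w" r R] by simp
qed (auto intro: pres_rel.refl pres_rel.sym pres_rel.trans)

lemma pres_rel_congruent2: "congruent2 (pres_rel X R) (pres_rel X R) (\<lambda>a b. pres_rel X R `` {a @ b})"
proof (rule congruent2I'[OF equiv_class_eq[OF equiv_pres_rel]])
  fix a a' b b' assume "(a, a') \<in> pres_rel X R" "(b, b') \<in> pres_rel X R"
  then show "(a @ b, a' @ b') \<in> pres_rel X R"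
    by (meson pres_rel_appendL pres_rel_appendR pres_rel_words pres_rel.trans)
qed

lemma presented_group_mult:
  assumes "u \<in> words X" "v \<in> words X"
  shows "(pres_rel X R `` {u}) \<otimes>\<^bsub>presented_group X R\<^esub> (pres_rel X R `` {v}) = pres_rel X R `` {u @ v}"
  using UN_equiv_class2[OF equiv_pres_rel equiv_pres_rel pres_rel_congruent2 assms]
  by (simp add: presented_group_def)

lemma pres_rel_inverse:
  "w \<in> words X \<Longrightarrow> (rev (map (\<lambda>(x, b). (x, \<not> b)) w) @ w, []) \<in> pres_rel X R
    \<and> rev (map (\<lambda>(x, b). (x, \<not> b)) w) \<in> words X"
proof (induction w)
  case Nil
  then show ?case by (simp add: pres_rel.refl)
next
  case (Cons l w)
  obtain x b where l: "l = (x, b)" by (cases l)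
  let ?i = "rev (map (\<lambda>(x, b). (x, \<not> b)) w)"
  have w: "w \<in> words X" and x: "x \<in> X" using Cons.prems by (auto simp: words_def l)
  have IH: "(?i @ w, []) \<in> pres_rel X R" "?i \<in> words X" using Cons.IH[OF w] by auto
  have "(?i @ [(x, \<not> b), (x, \<not> \<not> b)] @ w, ?i @ w) \<in> pres_rel X R"
    by (rule pres_rel.cancel[OF IH(2) w x])
  moreover have "[(x, \<not> b)] \<in> words X" using x by (simp add: words_def)
  ultimately show ?case using IH by (auto simp: l intro: pres_rel.trans)
qed

lemma group_presented_group: "group (presented_group X R)"
proof (rule groupI)
  let ?P = "presented_group X R" and ?c = "\<lambda>w. pres_rel X R `` {w}"
  have carr: "carrier ?P = words X // pres_rel X R" and one: "\<one>\<^bsub>?P\<^esub> = ?c []"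
    by (simp_all add: presented_group_def)
  have cls: "?c w \<in> carrier ?P" if "w \<in> words X" for w
    using that by (simp add: carr quotientI)
  note mult = presented_group_mult[of _ X _ R]
  show "\<one>\<^bsub>?P\<^esub> \<in> carrier ?P" by (simp add: one cls)
  fix a assume "a \<in> carrier ?P"
  then obtain u where u: "u \<in> words X" "a = ?c u" unfolding carr by (rule quotientE)
  show "\<one>\<^bsub>?P\<^esub> \<otimes>\<^bsub>?P\<^esub> a = a" using mult[of "[]" u] u by (simp add: one)
  show "\<exists>y\<in>carrier ?P. y \<otimes>\<^bsub>?P\<^esub> a = \<one>\<^bsub>?P\<^esub>"
  proof
    let ?i = "rev (map (\<lambda>(x, b). (x, \<not> b)) u)"
    have i: "(?i @ u, []) \<in> pres_rel X R" "?i \<in> words X"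
      using pres_rel_inverse[OF u(1)] by auto
    show "?c ?i \<in> carrier ?P" using i by (simp add: cls)
    show "?c ?i \<otimes>\<^bsub>?P\<^esub> a = \<one>\<^bsub>?P\<^esub>"
      using mult[OF i(2) u(1)] equiv_class_eq[OF equiv_pres_rel i(1)] by (simp add: one u(2))
  qed
  fix b assume "b \<in> carrier ?P"
  then obtain v where v: "v \<in> words X" "b = ?c v" unfolding carr by (rule quotientE)
  show "a \<otimes>\<^bsub>?P\<^esub> b \<in> carrier ?P" using u v by (simp add: mult cls)
  fix d assume "d \<in> carrier ?P"
  then obtain w where w: "w \<in> words X" "d = ?c w" unfolding carr by (rule quotientE)
  show "a \<otimes>\<^bsub>?P\<^esub> b \<otimes>\<^bsub>?P\<^esub> d = a \<otimes>\<^bsub>?P\<^esub> (b \<otimes>\<^bsub>?P\<^esub> d)" using u v w by (simp add: mult)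
qed


section \<open>Characters and the BNS-invariant\<close>

instantiation "fun" :: (type, real_vector) real_vector
begin

definition scaleR_fun :: "real \<Rightarrow> ('a \<Rightarrow> 'b) \<Rightarrow> 'a \<Rightarrow> 'b" where
  "scaleR_fun r f = (\<lambda>x. r *\<^sub>R f x)"

instance
  by standard (auto simp: scaleR_fun_def plus_fun_def algebra_simps)

end

definition real_group :: "real monoid" where
  "real_group = \<lparr>carrier = UNIV, monoid.mult = (+), one = 0\<rparr>"

text \<open>
  Characters are normalised to vanish outside the carrier, which makes Hom(G, R) a linear subspace of
  the space of all real functions on the underlying type.
\<close>

definition Hom_real :: "('a, 'b) monoid_scheme \<Rightarrow> ('a \<Rightarrow> real) set" where
  "Hom_real G = {\<chi> \<in> hom G real_group. \<forall>x. x \<notin> carrier G \<longrightarrow> \<chi> x = 0}"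

lemma subspace_Hom_real:
  assumes "group G"
  shows "subspace (Hom_real G)"
  using monoid.m_closed[OF group.is_monoid[OF assms]]
  by (intro subspaceI)
    (auto simp: Hom_real_def hom_def real_group_def scaleR_fun_def algebra_simps)

definition finite_generating_set :: "('a, 'b) monoid_scheme \<Rightarrow> 'a set \<Rightarrow> bool" where
  "finite_generating_set G S \<longleftrightarrow> finite S \<and> S \<subseteq> carrier G \<and> generate G S = carrier G"

definition finitely_generated :: "('a, 'b) monoid_scheme \<Rightarrow> bool" where
  "finitely_generated G \<longleftrightarrow> (\<exists>S. finite_generating_set G S)"

definition Cay :: "('a, 'b) monoid_scheme \<Rightarrow> 'a set \<Rightarrow> ('a, 'a \<times> 'a) pre_digraph" where
  "Cay G S = \<lparr>verts = carrier G, arcs = carrier G \<times> S,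
              tail = (\<lambda>(g, s). g), head = (\<lambda>(g, s). g \<otimes>\<^bsub>G\<^esub> s)\<rparr>"

definition char_class :: "('a \<Rightarrow> real) \<Rightarrow> ('a \<Rightarrow> real) set" where
  "char_class \<chi> = {c *\<^sub>R \<chi> | c. c > 0}"

definition char_sphere :: "('a, 'b) monoid_scheme \<Rightarrow> ('a \<Rightarrow> real) set set" where
  "char_sphere G = char_class ` (Hom_real G - {0})"

text \<open>
  \<^const>\<open>Digraph_Component.connected\<close> is connectedness of the underlying undirected graph. For
  finitely generated \<open>G\<close>, the condition depends neither on the finite generating set \<open>S\<close> nor on the
  representative \<open>\<chi>\<close>, so that universal quantification over them would define the same set.
\<close>

definition Sigma1 :: "('a, 'b) monoid_scheme \<Rightarrow> ('a \<Rightarrow> real) set set" where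
  "Sigma1 G = {p \<in> char_sphere G. \<exists>\<chi> \<in> Hom_real G - {0}. p = char_class \<chi> \<and>
     (\<exists>S. finite_generating_set G S \<and>
        Digraph_Component.connected
          (Cay G S \<restriction> {g \<in> carrier G. \<chi> g \<ge> 0}))}"

definition missing_subspace :: "('a, 'b) monoid_scheme \<Rightarrow> ('a \<Rightarrow> real) set \<Rightarrow> bool" where
  "missing_subspace G W \<longleftrightarrow>
     subspace W \<and> W \<subseteq> Hom_real G \<and> (\<forall>\<chi> \<in> W - {0}. char_class \<chi> \<notin> Sigma1 G)"

definition maximal_missing_subspace :: "('a, 'b) monoid_scheme \<Rightarrow> ('a \<Rightarrow> real) set \<Rightarrow> bool" where
  "maximal_missing_subspace G W \<longleftrightarrow>
     missing_subspace G W \<and> (\<forall>W'. missing_subspace G W' \<and> W \<subseteq> W' \<longrightarrow> W' = W)"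


section \<open>Redundant triples of subspaces\<close>

text \<open>
  The ambient space is a linear subspace \<open>V\<close> of a real vector space, so that its dimension \<open>n\<close> can be
  a term. Bases are functions on the index set \<open>{1..n}\<close>.
\<close>

definition inner_product_on :: "'v::real_vector set \<Rightarrow> ('v \<Rightarrow> 'v \<Rightarrow> real) \<Rightarrow> bool" where
  "inner_product_on V ip \<longleftrightarrow>
     (\<forall>u\<in>V. \<forall>v\<in>V. ip u v = ip v u) \<and>
     (\<forall>u\<in>V. \<forall>v\<in>V. \<forall>w\<in>V. ip (u + v) w = ip u w + ip v w) \<and>
     (\<forall>c. \<forall>u\<in>V. \<forall>w\<in>V. ip (c *\<^sub>R u) w = c * ip u w) \<and>
     (\<forall>u\<in>V. u \<noteq> 0 \<longrightarrow> ip u u > 0)"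

definition orthonormal_basis_on ::
  "'v::real_vector set \<Rightarrow> ('v \<Rightarrow> 'v \<Rightarrow> real) \<Rightarrow> nat \<Rightarrow> (nat \<Rightarrow> 'v) \<Rightarrow> bool" where
  "orthonormal_basis_on V ip n e \<longleftrightarrow>
     (\<forall>i\<in>{1..n}. \<forall>j\<in>{1..n}. ip (e i) (e j) = (if i = j then 1 else 0)) \<and>
     inj_on e {1..n} \<and> independent (e ` {1..n}) \<and> span (e ` {1..n}) = V"

definition coord :: "nat \<Rightarrow> (nat \<Rightarrow> 'v::real_vector) \<Rightarrow> nat \<Rightarrow> 'v \<Rightarrow> real" where
  "coord n e i v = representation (e ` {1..n}) v (e i)"

text \<open>
  \<open>W\<close> is the common kernel in \<open>V\<close> of \<open>f\<close> and \<open>m\<close> further linear forms, the \<open>m + 1\<close> forms being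
  independent, as expressed by \<open>dim W = n - (m + 1)\<close> (written without natural-number subtraction).
\<close>

definition cut_out_with ::
  "'v::real_vector set \<Rightarrow> nat \<Rightarrow> (nat \<Rightarrow> 'v) \<Rightarrow> ('v \<Rightarrow> real) \<Rightarrow> 'v set \<Rightarrow> bool" where
  "cut_out_with V n e f W \<longleftrightarrow>
     (\<exists>(m::nat) (l::nat \<Rightarrow> nat \<Rightarrow> real).
        W = {v \<in> V. f v = 0 \<and> (\<forall>j\<in>{1..m}. (\<Sum>i=1..n. l i j * coord n e i v) = 0)} \<and>
        dim W + (m + 1) = n)"

definition perp_in :: "'v::real_vector set \<Rightarrow> ('v \<Rightarrow> 'v \<Rightarrow> real) \<Rightarrow> 'v set \<Rightarrow> 'v set" where
  "perp_in V ip W = {v \<in> V. \<forall>w\<in>W. ip v w = 0}"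

definition redundant_triple ::
  "'v::real_vector set \<Rightarrow> ('v \<Rightarrow> 'v \<Rightarrow> real) \<Rightarrow> nat \<Rightarrow> (nat \<Rightarrow> 'v)
    \<Rightarrow> 'v set \<Rightarrow> 'v set \<Rightarrow> 'v set \<Rightarrow> bool" where
  "redundant_triple V ip n e W1 W2 W3 \<longleftrightarrow>
     2 \<le> n \<and> inner_product_on V ip \<and> orthonormal_basis_on V ip n e \<and>
     cut_out_with V n e (coord n e 1) W1 \<and>
     cut_out_with V n e (coord n e 2) W2 \<and>
     cut_out_with V n e (\<lambda>v. coord n e 1 v - coord n e 2 v) W3 \<and>
     (let P1 = perp_in V ip W1; P2 = perp_in V ip W2; P3 = perp_in V ip W3;
          K12 = {(u, - u, 0) | u. u \<in> P1 \<inter> P2};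
          K23 = {(0, u, - u) | u. u \<in> P2 \<inter> P3};
          K13 = {(u, 0, - u) | u. u \<in> P1 \<inter> P3};
          \<xi> = (- e 1, e 2, e 1 - e 2)
      in \<xi> \<notin> {a + b + c | a b c. a \<in> K12 \<and> b \<in> K23 \<and> c \<in> K13})"

end

theory Submission
  imports Defs
begin

text \<open>
  For a character \<open>\<chi>\<close> of a right-angled Artin group, membership in the BNS-invariant depends only on
  the set of vertices on which \<open>\<chi>\<close> does not vanish, and non-membership is inherited by nonzero
  characters of smaller support. A maximal missing subspace contains a character of maximal support,
  so it consists of all characters supported in that set, that is, it is cut out by some of the
  coordinate functionals. The orthogonal complements of three such subspaces are therefore spanned
  by subsets of one common basis, along which \<open>\<xi>\<close> decomposes; no such triple is redundant.
\<close>

section \<open>Presented groups\<close>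

text \<open>Membership in \<open>Sigma1\<close> needs only one finite generating set, and the vertex
  generators serve. Non-membership has to be shown for every finite generating set, so it cannot be
  read off one Cayley graph. It is certified by a homomorphism into an auxiliary group whose second
  component is a cocycle with values in functions on the line; such a certificate does not refer to
  generators. In the linear algebra, the given orthonormal basis is unrelated to the vertices. The
  common basis of the complements consists of the Riesz vectors of the evaluations at the vertex
  generators. Spans of subsets of one basis form a distributive lattice under sum and intersection,
  and a redundant triple would witness a failure of distributivity among the three
  complements.\<close>

definition word_eval :: "('h, 'c) monoid_scheme \<Rightarrow> ('x \<Rightarrow> 'h) \<Rightarrow> 'x word \<Rightarrow> 'h" where
  "word_eval H f w =
     foldr (\<lambda>(x, b) y. (if b then f x else inv\<^bsub>H\<^esub> (f x)) \<otimes>\<^bsub>H\<^esub> y) w \<one>\<^bsub>H\<^esub>"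

lemma word_eval_Nil [simp]: "word_eval H f [] = \<one>\<^bsub>H\<^esub>"
  by (simp add: word_eval_def)

lemma word_eval_Cons [simp]:
  "word_eval H f ((x, b) # w) = (if b then f x else inv\<^bsub>H\<^esub> (f x)) \<otimes>\<^bsub>H\<^esub> word_eval H f w"
  by (simp add: word_eval_def)

context
  fixes H :: "('h, 'c) monoid_scheme" (structure) and X :: "'x set" and f :: "'x \<Rightarrow> 'h"
  assumes H: "group H" and f: "f \<in> X \<rightarrow> carrier H"
begin

interpretation group H by (rule H)

lemma word_eval_closed: "w \<in> words X \<Longrightarrow> word_eval H f w \<in> carrier H"
  using f by (induction w) (auto simp: words_def Pi_iff)

lemma word_eval_append:
  "u \<in> words X \<Longrightarrow> v \<in> words X \<Longrightarrow> word_eval H f (u @ v) = word_eval H f u \<otimes> word_eval H f v"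
proof (induction u)
  case Nil
  then show ?case by (simp add: word_eval_closed)
next
  case (Cons l u)
  obtain x b where l: "l = (x, b)" by (cases l)
  have "u \<in> words X" "f x \<in> carrier H" using Cons.prems f by (auto simp: words_def l)
  then show ?case using Cons by (auto simp: l m_assoc word_eval_closed)
qed

lemma word_eval_pres_rel:
  assumes R: "\<And>r. r \<in> R \<Longrightarrow> r \<in> words X \<Longrightarrow> word_eval H f r = \<one>"
    and "(u, v) \<in> pres_rel X R"
  shows "word_eval H f u = word_eval H f v"
  using assms(2)
proof (induction rule: pres_rel.induct)
  case (cancel u v x b)
  then have "(x, b) # (x, \<not> b) # v \<in> words X" "f x \<in> carrier H"
    using f by (auto simp: words_def)
  moreover from this cancel have "word_eval H f ((x, b) # (x, \<not> b) # v) = word_eval H f v"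
    by (simp add: word_eval_closed flip: m_assoc)
  ultimately show ?case using cancel by (simp add: word_eval_append)
next
  case (relator u v r)
  then show ?case by (simp add: word_eval_append word_eval_closed R)
qed auto

text \<open>Von Dyck's universal property. Evaluating an arbitrarily chosen representative is
  harmless because evaluation is constant on the classes of \<open>pres_rel\<close>.\<close>

lemma presented_group_hom_exists:
  assumes R: "\<And>r. r \<in> R \<Longrightarrow> r \<in> words X \<Longrightarrow> word_eval H f r = \<one>"
  obtains h where "h \<in> hom (presented_group X R) H"
    and "\<And>x. x \<in> X \<Longrightarrow> h (pres_rel X R `` {[(x, True)]}) = f x"
proof
  define h where "h = (\<lambda>A. word_eval H f (SOME w. w \<in> A))"
  have h_class: "h (pres_rel X R `` {w}) = word_eval H f w" if "w \<in> words X" for w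
  proof -
    have "w \<in> pres_rel X R `` {w}" using that by (auto intro: pres_rel.refl)
    then have "(SOME u. u \<in> pres_rel X R `` {w}) \<in> pres_rel X R `` {w}" by (rule someI)
    then show ?thesis unfolding h_def using word_eval_pres_rel[OF R] by fastforce
  qed
  have carr: "carrier (presented_group X R) = words X // pres_rel X R"
    by (simp add: presented_group_def)
  show "h \<in> hom (presented_group X R) H"
  proof (rule homI)
    fix A assume "A \<in> carrier (presented_group X R)"
    then obtain u where u: "u \<in> words X" "A = pres_rel X R `` {u}"
      unfolding carr by (rule quotientE)
    show "h A \<in> carrier H" using u by (simp add: h_class word_eval_closed)
    fix B assume "B \<in> carrier (presented_group X R)"
    then obtain v where v: "v \<in> words X" "B = pres_rel X R `` {v}"
      unfolding carr by (rule quotientE)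
    show "h (A \<otimes>\<^bsub>presented_group X R\<^esub> B) = h A \<otimes> h B"
      using u v by (simp add: presented_group_mult h_class word_eval_append)
  qed
  fix x assume "x \<in> X"
  then show "h (pres_rel X R `` {[(x, True)]}) = f x"
    using f by (subst h_class) (auto simp: words_def Pi_iff)
qed

end

lemma presented_group_generator_closed:
  "x \<in> X \<Longrightarrow> pres_rel X R `` {[(x, b)]} \<in> carrier (presented_group X R)"
  by (auto simp: presented_group_def words_def intro!: quotientI)

text \<open>Only the positive letters are listed as generators; a cancelling pair identifies the
  class of a negative letter with the inverse of a generator.\<close>

lemma generate_presented_group:
  "generate (presented_group X R) ((\<lambda>x. pres_rel X R `` {[(x, True)]}) ` X)
    = carrier (presented_group X R)" (is "generate ?P (?g ` X) = _")
proof
  interpret P: group ?P by (rule group_presented_group)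
  show "generate ?P (?g ` X) \<subseteq> carrier ?P"
    by (rule P.generate_incl) (auto intro: presented_group_generator_closed)
  have letter: "pres_rel X R `` {[(x, b)]} \<in> generate ?P (?g ` X)" if x: "x \<in> X" for x b
  proof (cases b)
    case True
    then show ?thesis using x by (auto intro: generate.incl)
  next
    case False
    have "pres_rel X R `` {[(x, False)]} = inv\<^bsub>?P\<^esub> (?g x)"
    proof (rule P.inv_equality[symmetric])
      have "([] @ [(x, False), (x, \<not> False)] @ [], [] @ []) \<in> pres_rel X R"
        using x by (intro pres_rel.cancel) auto
      then have "([(x, False), (x, True)], []) \<in> pres_rel X R" by simp
      then have "pres_rel X R `` {[(x, False), (x, True)]} = pres_rel X R `` {[]}"
        by (rule equiv_class_eq[OF equiv_pres_rel])
      then show "pres_rel X R `` {[(x, False)]} \<otimes>\<^bsub>?P\<^esub> ?g x = \<one>\<^bsub>?P\<^esub>"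
        using x by (subst presented_group_mult) (auto simp: words_def presented_group_def)
    qed (use x in \<open>auto intro: presented_group_generator_closed\<close>)
    then show ?thesis using False x by (auto intro: generate.inv)
  qed
  have "pres_rel X R `` {w} \<in> generate ?P (?g ` X)" if "w \<in> words X" for w
    using that
  proof (induction w)
    case Nil
    then show ?case using generate.one[of ?P] by (simp add: presented_group_def)
  next
    case (Cons l w)
    obtain x b where l: "l = (x, b)" by (cases l)
    have x: "x \<in> X" "[(x, b)] \<in> words X" and w: "w \<in> words X"
      using Cons.prems by (auto simp: words_def l)
    have "pres_rel X R `` {l # w} = (pres_rel X R `` {[(x, b)]}) \<otimes>\<^bsub>?P\<^esub> (pres_rel X R `` {w})"
      using presented_group_mult[OF x(2) w, of R] by (simp add: l)
    then show ?case using generate.eng[OF letter[OF x(1)] Cons.IH[OF w]] by simp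
  qed
  then show "carrier ?P \<subseteq> generate ?P (?g ` X)"
    by (auto simp: presented_group_def elim!: quotientE)
qed

section \<open>Characters and half-spaces of Cayley graphs\<close>

lemma Hom_real_mult:
  "\<chi> \<in> Hom_real G \<Longrightarrow> g \<in> carrier G \<Longrightarrow> h \<in> carrier G \<Longrightarrow> \<chi> (g \<otimes>\<^bsub>G\<^esub> h) = \<chi> g + \<chi> h"
  by (auto simp: Hom_real_def hom_def real_group_def)

lemma (in group) Hom_real_one: "\<chi> \<in> Hom_real G \<Longrightarrow> \<chi> \<one> = 0"
  using Hom_real_mult[of \<chi> G \<one> \<one>] by simp

lemma (in group) Hom_real_inv: "\<chi> \<in> Hom_real G \<Longrightarrow> g \<in> carrier G \<Longrightarrow> \<chi> (inv g) = - \<chi> g"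
  using Hom_real_mult[of \<chi> G g "inv g"] by (simp add: Hom_real_one)

lemma (in group) Hom_real_pow:
  fixes k :: nat
  shows "\<chi> \<in> Hom_real G \<Longrightarrow> g \<in> carrier G \<Longrightarrow> \<chi> (g [^] k) = real k * \<chi> g"
  by (induction k) (auto simp: Hom_real_one Hom_real_mult algebra_simps)

text \<open>\<open>Sigma1\<close> may use any positive multiple of \<open>\<chi>\<close> as
  representative, but all of them have the same half-space. The generating set remains
  existential.\<close>

lemma char_class_in_Sigma1_iff:
  assumes "\<chi> \<in> Hom_real G - {0}"
  shows "char_class \<chi> \<in> Sigma1 G \<longleftrightarrow> (\<exists>S. finite_generating_set G S \<and>
    Digraph_Component.connected (Cay G S \<restriction> {g \<in> carrier G. \<chi> g \<ge> 0}))"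
proof
  assume "char_class \<chi> \<in> Sigma1 G"
  then obtain \<psi> S where \<psi>: "char_class \<chi> = char_class \<psi>"
    and S: "finite_generating_set G S"
      "Digraph_Component.connected (Cay G S \<restriction> {g \<in> carrier G. \<psi> g \<ge> 0})"
    unfolding Sigma1_def by auto
  have "\<psi> \<in> char_class \<psi>" unfolding char_class_def by (auto intro!: exI[of _ 1])
  then obtain c where "c > 0" "\<psi> = c *\<^sub>R \<chi>"
    unfolding \<psi>[symmetric] by (auto simp: char_class_def)
  then have "{g \<in> carrier G. \<psi> g \<ge> 0} = {g \<in> carrier G. \<chi> g \<ge> 0}"
    by (auto simp: scaleR_fun_def zero_le_mult_iff)
  then show "\<exists>S. finite_generating_set G S \<and>
    Digraph_Component.connected (Cay G S \<restriction> {g \<in> carrier G. \<chi> g \<ge> 0})" using S by auto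
next
  assume "\<exists>S. finite_generating_set G S \<and>
    Digraph_Component.connected (Cay G S \<restriction> {g \<in> carrier G. \<chi> g \<ge> 0})"
  then show "char_class \<chi> \<in> Sigma1 G"
    using assms unfolding Sigma1_def char_sphere_def by blast
qed

definition Cay_conn :: "('a, 'b) monoid_scheme \<Rightarrow> 'a set \<Rightarrow> 'a set \<Rightarrow> 'a \<Rightarrow> 'a \<Rightarrow> bool" where
  "Cay_conn G S P x y \<longleftrightarrow> x \<rightarrow>\<^sup>*\<^bsub>with_proj (mk_symmetric (Cay G S \<restriction> P))\<^esub> y"

lemma parcs_Cay_restrict:
  "parcs (mk_symmetric (Cay G S \<restriction> P)) =
     {(x, y). x \<in> P \<and> y \<in> P \<and> (\<exists>s\<in>S. x \<in> carrier G \<and> y = x \<otimes>\<^bsub>G\<^esub> s \<or> y \<in> carrier G \<and> x = y \<otimes>\<^bsub>G\<^esub> s)}"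
  by (force simp: parcs_mk_symmetric induce_subgraph_def Cay_def)

lemma connected_Cay_restrict_iff:
  "Digraph_Component.connected (Cay G S \<restriction> P) \<longleftrightarrow>
     P \<noteq> {} \<and> (\<forall>x\<in>P. \<forall>y\<in>P. Cay_conn G S P x y)"
  by (auto simp: Digraph_Component.connected_def strongly_connected_def Cay_conn_def
      induce_subgraph_def)

lemma Cay_conn_refl: "x \<in> P \<Longrightarrow> Cay_conn G S P x x"
  by (simp add: Cay_conn_def reachable_def induce_subgraph_def)

lemma Cay_conn_trans: "Cay_conn G S P x y \<Longrightarrow> Cay_conn G S P y z \<Longrightarrow> Cay_conn G S P x z"
  unfolding Cay_conn_def reachable_def by (rule rtrancl_on_trans)

lemma Cay_conn_sym: "Cay_conn G S P x y \<Longrightarrow> Cay_conn G S P y x"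
  unfolding Cay_conn_def
  by (rule symmetric_reachable) (auto simp: symmetric_def sym_def parcs_Cay_restrict)

lemma Cay_conn_step:
  assumes "x \<in> P" "x \<in> carrier G" "s \<in> S" "x \<otimes>\<^bsub>G\<^esub> s \<in> P"
  shows "Cay_conn G S P x (x \<otimes>\<^bsub>G\<^esub> s)"
proof -
  have "(x, x \<otimes>\<^bsub>G\<^esub> s) \<in> parcs (mk_symmetric (Cay G S \<restriction> P))"
    using assms by (auto simp: parcs_Cay_restrict)
  then show ?thesis using assms
    unfolding Cay_conn_def reachable_def
    by (intro rtrancl_on_into_rtrancl_on[OF rtrancl_on_refl])
      (auto simp: induce_subgraph_def)
qed

text \<open>The tool for separating components. The edge condition is an equivalence because edges
  may be traversed backwards.\<close>

lemma Cay_conn_invariant: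
  assumes "Cay_conn G S P x y" and "Q x"
    and "\<And>z s. z \<in> P \<Longrightarrow> z \<in> carrier G \<Longrightarrow> s \<in> S \<Longrightarrow> z \<otimes>\<^bsub>G\<^esub> s \<in> P \<Longrightarrow> Q z \<longleftrightarrow> Q (z \<otimes>\<^bsub>G\<^esub> s)"
  shows "Q y"
  using assms(1,2) unfolding Cay_conn_def reachable_def
  by (induction rule: rtrancl_on_induct) (auto simp: parcs_Cay_restrict assms(3))

section \<open>Splittings obstruct membership in the BNS-invariant\<close>

text \<open>
  The semidirect product of the real functions that vanish near \<open>-\<infinity>\<close> with the additive group of
  reals, acting by translation. A homomorphism into it is a character together with a cocycle.
\<close>

definition shift_group :: "(real \<times> (real \<Rightarrow> real)) monoid" where
  "shift_group =
    \<lparr> carrier = {(r, f). \<exists>c. \<forall>x<c. f x = 0},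
      monoid.mult = (\<lambda>(r, f) (s, h). (r + s, \<lambda>x. f x + h (x - r))),
      one = (0, \<lambda>x. 0) \<rparr>"

lemma shift_group_simps:
  "(r, f) \<in> carrier shift_group \<longleftrightarrow> (\<exists>c. \<forall>x<c. f x = 0)"
  "(r, f) \<otimes>\<^bsub>shift_group\<^esub> (s, h) = (r + s, \<lambda>x. f x + h (x - r))"
  "\<one>\<^bsub>shift_group\<^esub> = (0, \<lambda>x. 0)"
  by (simp_all add: shift_group_def)

lemma group_shift_group: "group shift_group"
proof (rule groupI)
  show "\<one>\<^bsub>shift_group\<^esub> \<in> carrier shift_group" by (simp add: shift_group_simps)
  fix p assume p: "p \<in> carrier shift_group"
  obtain r f where rf: "p = (r, f)" by (cases p)
  obtain c where c: "\<And>x. x < c \<Longrightarrow> f x = 0" using p by (auto simp: rf shift_group_simps)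
  show "\<one>\<^bsub>shift_group\<^esub> \<otimes>\<^bsub>shift_group\<^esub> p = p" by (simp add: shift_group_simps rf)
  show "\<exists>q\<in>carrier shift_group. q \<otimes>\<^bsub>shift_group\<^esub> p = \<one>\<^bsub>shift_group\<^esub>"
  proof
    show "(- r, \<lambda>x. - f (x + r)) \<in> carrier shift_group"
      unfolding shift_group_simps by (rule exI[of _ "c - r"]) (auto intro: c)
    show "(- r, \<lambda>x. - f (x + r)) \<otimes>\<^bsub>shift_group\<^esub> p = \<one>\<^bsub>shift_group\<^esub>"
      by (simp add: shift_group_simps rf)
  qed
  fix q assume q: "q \<in> carrier shift_group"
  obtain s h where sh: "q = (s, h)" by (cases q)
  obtain d where d: "\<And>x. x < d \<Longrightarrow> h x = 0" using q by (auto simp: sh shift_group_simps)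
  show "p \<otimes>\<^bsub>shift_group\<^esub> q \<in> carrier shift_group"
    unfolding rf sh shift_group_simps by (rule exI[of _ "min c (d + r)"]) (auto simp: c d)
  fix u assume "u \<in> carrier shift_group"
  show "p \<otimes>\<^bsub>shift_group\<^esub> q \<otimes>\<^bsub>shift_group\<^esub> u = p \<otimes>\<^bsub>shift_group\<^esub> (q \<otimes>\<^bsub>shift_group\<^esub> u)"
    by (cases u) (simp add: shift_group_simps rf sh algebra_simps)
qed

text \<open>
  On a connected half-space, the cocycle can only pick up translates to the right of its values on
  the finitely many generators, so its supports are uniformly bounded below; conjugating \<open>q\<close> by
  powers of \<open>t\<close> violates this.
\<close>

lemma (in group) char_class_notin_Sigma1:
  assumes \<chi>: "\<chi> \<in> Hom_real G - {0}"
    and \<theta>: "\<theta> \<in> hom G shift_group" and fst_\<theta>: "\<And>g. g \<in> carrier G \<Longrightarrow> fst (\<theta> g) = \<chi> g"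
    and t: "t \<in> carrier G" "\<chi> t < 0" "snd (\<theta> t) = (\<lambda>x. 0)"
    and q: "q \<in> carrier G" "\<chi> q \<ge> 0" "snd (\<theta> q) x0 \<noteq> 0"
  shows "char_class \<chi> \<notin> Sigma1 G"
proof
  assume "char_class \<chi> \<in> Sigma1 G"
  let ?P = "{g \<in> carrier G. \<chi> g \<ge> 0}"
  obtain S where S: "finite_generating_set G S"
    and conn: "Digraph_Component.connected (Cay G S \<restriction> ?P)"
    using \<open>char_class \<chi> \<in> Sigma1 G\<close> char_class_in_Sigma1_iff[OF \<chi>] by blast
  have \<chi>H: "\<chi> \<in> Hom_real G" using \<chi> by blast
  define b where "b g = snd (\<theta> g)" for g
  have \<theta>_eq: "\<theta> g = (\<chi> g, b g)" if "g \<in> carrier G" for g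
    using fst_\<theta>[OF that] by (simp add: b_def prod_eq_iff)
  have b_mult: "b (g \<otimes> h) = (\<lambda>x. b g x + b h (x - \<chi> g))"
    if "g \<in> carrier G" "h \<in> carrier G" for g h
    using hom_mult[OF \<theta> that] that by (simp add: \<theta>_eq shift_group_simps)
  have b_one: "b \<one> = (\<lambda>x. 0)"
    using b_mult[of \<one> \<one>] by (simp add: fun_eq_iff Hom_real_one[OF \<chi>H])
  have b_bdd: "\<exists>c. \<forall>x<c. b g x = 0" if "g \<in> carrier G" for g
    using hom_in_carrier[OF \<theta> that] that by (simp add: \<theta>_eq shift_group_simps)
  have S_carr: "S \<subseteq> carrier G" and "finite S"
    using S by (auto simp: finite_generating_set_def)
  from \<open>finite S\<close> S_carr have "\<exists>c. \<forall>s\<in>S. \<forall>x<c. b s x = 0"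
  proof (induction S)
    case (insert s S)
    then obtain c d where "\<forall>s\<in>S. \<forall>x<c. b s x = 0" "\<forall>x<d. b s x = 0"
      using b_bdd by (metis insert_subset)
    then show ?case by (intro exI[of _ "min c d"]) auto
  qed auto
  then obtain c where c: "\<And>s x. s \<in> S \<Longrightarrow> x < c \<Longrightarrow> b s x = 0" by blast
  have bounded: "b g x = 0" if "g \<in> ?P" "x < c" for g x
  proof -
    have "\<one> \<in> ?P" by (simp add: Hom_real_one[OF \<chi>H])
    then have "Cay_conn G S ?P \<one> g" using conn that unfolding connected_Cay_restrict_iff by blast
    then have "\<forall>x<c. b g x = 0"
    proof (rule Cay_conn_invariant)
      fix z s assume z: "z \<in> ?P" and s: "s \<in> S"
      \<comment> \<open>This is where the half-space enters: \<open>\<chi> z \<ge> 0\<close> gives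
        \<open>x - \<chi> z \<le> x < c\<close>.\<close>
      then have "b s (x - \<chi> z) = 0" if "x < c" for x using that by (intro c) auto
      then show "(\<forall>x<c. b z x = 0) \<longleftrightarrow> (\<forall>x<c. b (z \<otimes> s) x = 0)"
        using z s S_carr by (subst b_mult) auto
    qed (simp add: b_one)
    then show ?thesis using that by blast
  qed
  have b_pow: "b (t [^] k) = (\<lambda>x. 0)" for k :: nat
    using t by (induction k) (auto simp: b_one b_mult b_def[of t, symmetric])
  have b_inv_pow: "b (inv (t [^] k)) = (\<lambda>x. 0)" for k :: nat
  proof
    fix x
    have "b (t [^] k \<otimes> inv (t [^] k)) (x + \<chi> (t [^] k)) = b (inv (t [^] k)) x"
      using t by (subst b_mult) (auto simp: b_pow)
    then show "b (inv (t [^] k)) x = 0" using t by (simp add: b_one)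
  qed
  \<comment> \<open>Conjugating \<open>q\<close> by \<open>t [^] k\<close> leaves its character
    value unchanged but translates its cocycle by \<open>k * \<chi> t\<close>, which is negative.
    The chosen \<open>k\<close> moves the nonzero value at \<open>x0\<close> below the bound
    \<open>c\<close>.\<close>
  obtain k :: nat where k: "x0 - c < real k * - \<chi> t"
    using reals_Archimedean3[of "- \<chi> t"] t by auto
  let ?g = "t [^] k \<otimes> (q \<otimes> inv (t [^] k))"
  have "\<chi> ?g = \<chi> q"
    using t q by (simp add: Hom_real_mult[OF \<chi>H] Hom_real_inv[OF \<chi>H])
  then have "?g \<in> ?P" using t q by simp
  moreover have "x0 + real k * \<chi> t < c" using k by (simp add: algebra_simps)
  ultimately have "b ?g (x0 + real k * \<chi> t) = 0" by (rule bounded)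
  moreover have "b ?g (x0 + real k * \<chi> t) = b q x0"
    using t q by (simp add: b_mult b_pow b_inv_pow Hom_real_pow[OF \<chi>H])
  ultimately show False using q by (simp add: b_def)
qed

section \<open>Right-angled Artin groups\<close>

lemma (in group) commute_inv:
  assumes "x \<otimes> y = y \<otimes> x" "x \<in> carrier G" "y \<in> carrier G"
  shows "inv x \<otimes> y = y \<otimes> inv x"
proof -
  have "inv x \<otimes> y = inv x \<otimes> (y \<otimes> x) \<otimes> inv x"
    using assms(2,3) by (simp add: m_assoc)
  also have "\<dots> = inv x \<otimes> (x \<otimes> y) \<otimes> inv x"
    by (simp only: assms(1))
  also have "\<dots> = y \<otimes> inv x"
    using assms(2,3) by (simp flip: m_assoc)
  finally show ?thesis .
qed

text \<open>With the isomorphism fixed, characters, half-spaces and Cayley graphs stay on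
  \<open>G\<close>; only the vertex generators and the universal property are transported.\<close>

locale raag_iso = group G for G :: "('a, 'b) monoid_scheme" (structure) +
  fixes \<Gamma> :: "'v pair_pre_digraph" and \<phi> :: "'a \<Rightarrow> 'v word set"
  assumes \<Gamma>: "pair_graph \<Gamma>" and \<phi>: "\<phi> \<in> iso G (raag \<Gamma>)"
begin

interpretation \<Gamma>: pair_graph \<Gamma> by (rule \<Gamma>)

abbreviation "relators \<equiv> {commutator_word v w | v w. (v, w) \<in> parcs \<Gamma>}"

definition gen :: "'v \<Rightarrow> 'a" where
  "gen v = inv_into (carrier G) \<phi> (pres_rel (pverts \<Gamma>) relators `` {[(v, True)]})"

lemma adjacent_sym: "(v, w) \<in> parcs \<Gamma> \<Longrightarrow> (w, v) \<in> parcs \<Gamma>"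
  using \<Gamma>.pair_sym_arcs by (auto simp: symmetric_def dest: symD)

lemma \<phi>_gen: "v \<in> pverts \<Gamma> \<Longrightarrow> \<phi> (gen v) = pres_rel (pverts \<Gamma>) relators `` {[(v, True)]}"
  and gen_closed [simp]: "v \<in> pverts \<Gamma> \<Longrightarrow> gen v \<in> carrier G"
  using \<phi> presented_group_generator_closed[of v "pverts \<Gamma>" relators True]
  by (auto simp: gen_def iso_def bij_betw_def raag_def f_inv_into_f inv_into_into)

lemma generate_gen: "generate G (gen ` pverts \<Gamma>) = carrier G"
proof -
  let ?A = "raag \<Gamma>" and ?\<psi> = "inv_into (carrier G) \<phi>"
  interpret A: group ?A unfolding raag_def by (rule group_presented_group)
  interpret \<psi>: group_hom ?A G ?\<psi>
    using iso_set_sym[OF \<phi>] by unfold_locales (auto simp: iso_def)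
  let ?g = "\<lambda>v. pres_rel (pverts \<Gamma>) relators `` {[(v, True)]}"
  have "gen ` pverts \<Gamma> = ?\<psi> ` ?g ` pverts \<Gamma>"
    by (auto simp: gen_def)
  moreover have "?g ` pverts \<Gamma> \<subseteq> carrier ?A"
    by (auto simp: raag_def intro: presented_group_generator_closed)
  ultimately have "generate G (gen ` pverts \<Gamma>) = ?\<psi> ` generate ?A (?g ` pverts \<Gamma>)"
    using \<psi>.generate_img by simp
  also have "generate ?A (?g ` pverts \<Gamma>) = carrier ?A"
    unfolding raag_def by (rule generate_presented_group)
  also have "?\<psi> ` carrier ?A = carrier G"
    using iso_set_sym[OF \<phi>] by (auto simp: iso_def bij_betw_def)
  finally show ?thesis .
qed

lemma finite_generating_set_gen: "finite_generating_set G (gen ` pverts \<Gamma>)"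
  using \<Gamma>.pair_finite_verts by (auto simp: finite_generating_set_def generate_gen)

lemma gen_commute:
  \<comment> \<open>The word \<open>commutator_word v w\<close> followed by \<open>w v\<close>
    reduces in two ways: deleting the relator leaves \<open>w v\<close>, whereas cancelling first
    the letters of \<open>w\<close> and then those of \<open>v\<close> leaves
    \<open>v w\<close>.\<close>
  assumes "(v, w) \<in> parcs \<Gamma>"
  shows "gen v \<otimes> gen w = gen w \<otimes> gen v"
proof -
  let ?X = "pverts \<Gamma>" and ?A = "raag \<Gamma>"
  let ?c = "\<lambda>w. pres_rel ?X relators `` {w}"
  have vw: "v \<in> ?X" "w \<in> ?X" using assms \<Gamma>.in_arcsD1 \<Gamma>.in_arcsD2 by auto
  then have W: "[(v, True), (w, True)] \<in> words ?X" "[(w, True), (v, True)] \<in> words ?X"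
    "commutator_word v w \<in> words ?X"
    by (auto simp: words_def commutator_word_def)
  have rel: "([] @ commutator_word v w @ [(w, True), (v, True)], [] @ [(w, True), (v, True)])
      \<in> pres_rel ?X relators"
    by (rule pres_rel.relator) (use assms W in auto)
  have "([(v, True), (w, True), (v, False)] @ [(w, False), (w, \<not> False)] @ [(v, True)],
      [(v, True), (w, True), (v, False)] @ [(v, True)]) \<in> pres_rel ?X relators"
    by (rule pres_rel.cancel) (use vw in \<open>auto simp: words_def\<close>)
  moreover have "([(v, True), (w, True)] @ [(v, False), (v, \<not> False)] @ [],
      [(v, True), (w, True)] @ []) \<in> pres_rel ?X relators"
    by (rule pres_rel.cancel) (use vw in \<open>auto simp: words_def\<close>)
  ultimately have "(commutator_word v w @ [(w, True), (v, True)], [(v, True), (w, True)])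
      \<in> pres_rel ?X relators"
    by (auto simp: commutator_word_def intro: pres_rel.trans)
  with rel have "([(v, True), (w, True)], [(w, True), (v, True)]) \<in> pres_rel ?X relators"
    by (auto intro: pres_rel.trans pres_rel.sym)
  then have "?c [(v, True), (w, True)] = ?c [(w, True), (v, True)]"
    by (rule equiv_class_eq[OF equiv_pres_rel])
  moreover have "\<phi> (gen x \<otimes> gen y) = ?c [(x, True), (y, True)]" if "x \<in> ?X" "y \<in> ?X" for x y
  proof -
    have "\<phi> (gen x \<otimes> gen y) = \<phi> (gen x) \<otimes>\<^bsub>?A\<^esub> \<phi> (gen y)"
      using \<phi> that by (auto simp: iso_def hom_def)
    also have "\<dots> = ?c ([(x, True)] @ [(y, True)])"
      using that unfolding \<phi>_gen[OF that(1)] \<phi>_gen[OF that(2)] raag_def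
      by (intro presented_group_mult) (auto simp: words_def)
    finally show ?thesis by simp
  qed
  ultimately have "\<phi> (gen v \<otimes> gen w) = \<phi> (gen w \<otimes> gen v)" using vw by simp
  then show ?thesis using \<phi> vw by (auto simp: iso_def bij_betw_def dest: inj_onD)
qed

lemma hom_exists:
  assumes H: "group H" and f: "f \<in> pverts \<Gamma> \<rightarrow> carrier H"
    and comm: "\<And>v w. (v, w) \<in> parcs \<Gamma> \<Longrightarrow> f v \<otimes>\<^bsub>H\<^esub> f w = f w \<otimes>\<^bsub>H\<^esub> f v"
  obtains h where "h \<in> hom G H" and "\<And>v. v \<in> pverts \<Gamma> \<Longrightarrow> h (gen v) = f v"
proof -
  interpret H: group H by (rule H)
  have "word_eval H f r = \<one>\<^bsub>H\<^esub>" if rel: "r \<in> relators" for r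
  proof -
    obtain v w where r: "r = commutator_word v w" and E: "(v, w) \<in> parcs \<Gamma>" using rel by auto
    have [simp]: "f v \<in> carrier H" "f w \<in> carrier H"
      using f \<Gamma>.in_arcsD1[OF E] \<Gamma>.in_arcsD2[OF E] by auto
    have "word_eval H f r = (f v \<otimes>\<^bsub>H\<^esub> f w) \<otimes>\<^bsub>H\<^esub> inv\<^bsub>H\<^esub> (f w \<otimes>\<^bsub>H\<^esub> f v)"
      by (simp add: r commutator_word_def H.m_assoc H.inv_mult_group)
    then show ?thesis by (simp add: comm[OF E])
  qed
  then obtain h where h: "h \<in> hom (raag \<Gamma>) H"
    "\<And>v. v \<in> pverts \<Gamma> \<Longrightarrow> h (pres_rel (pverts \<Gamma>) relators `` {[(v, True)]}) = f v"
    using presented_group_hom_exists[OF H f, of relators] unfolding raag_def by blast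
  show ?thesis
  proof
    show "h \<circ> \<phi> \<in> hom G H" using \<phi> h(1) Group.hom_compose[of \<phi> G "raag \<Gamma>" h H] by (auto simp: iso_def)
    show "(h \<circ> \<phi>) (gen v) = f v" if "v \<in> pverts \<Gamma>" for v
      using that by (simp add: \<phi>_gen h(2))
  qed
qed

text \<open>Multiplying by letters on the right means walking along Cayley edges. Since
  \<open>generate\<close> closes under arbitrary products, the induction is on the stronger claim
  that right multiplication by \<open>g\<close> preserves \<open>P\<close>.\<close>

lemma gen_induct [consumes 1, case_names one gen inv_gen]:
  assumes "g \<in> carrier G" and one: "P \<one>"
    and gen: "\<And>h v. h \<in> carrier G \<Longrightarrow> P h \<Longrightarrow> v \<in> pverts \<Gamma> \<Longrightarrow> P (h \<otimes> gen v)"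
    and inv_gen: "\<And>h v. h \<in> carrier G \<Longrightarrow> P h \<Longrightarrow> v \<in> pverts \<Gamma> \<Longrightarrow> P (h \<otimes> inv (gen v))"
  shows "P g"
proof -
  have "\<forall>h\<in>carrier G. P h \<longrightarrow> P (h \<otimes> g)" if "g \<in> generate G (gen ` pverts \<Gamma>)"
    using that
  proof (induction rule: generate.induct)
    case (eng g h)
    then show ?case
      by (metis generate_gen m_assoc m_closed)
  qed (auto intro: gen inv_gen)
  then show ?thesis using assms(1) one by (force simp: generate_gen)
qed

section \<open>Characters as real functions on the vertices\<close>

lemma Hom_real_ext:
  assumes "\<chi> \<in> Hom_real G" "\<psi> \<in> Hom_real G" and "\<And>v. v \<in> pverts \<Gamma> \<Longrightarrow> \<chi> (gen v) = \<psi> (gen v)"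
  shows "\<chi> = \<psi>"
proof
  fix g
  show "\<chi> g = \<psi> g"
  proof (cases "g \<in> carrier G")
    case True
    then show ?thesis using assms
      by (induction rule: gen_induct) (auto simp: Hom_real_one Hom_real_mult Hom_real_inv)
  next
    case False
    then show ?thesis using assms by (auto simp: Hom_real_def)
  qed
qed

text \<open>The relators are commutators and the target is abelian, so the values on vertices are
  unconstrained. Together with \<open>Hom_real_ext\<close> this identifies \<open>Hom_real G\<close>
  with the functions on the vertex set.\<close>

lemma Hom_real_exists:
  obtains \<chi> where "\<chi> \<in> Hom_real G" and "\<And>v. v \<in> pverts \<Gamma> \<Longrightarrow> \<chi> (gen v) = c v"
proof -
  have "group real_group"
    by (rule groupI) (auto simp: real_group_def intro: exI[of _ "- _"])
  then obtain h where h: "h \<in> hom G real_group" "\<And>v. v \<in> pverts \<Gamma> \<Longrightarrow> h (gen v) = c v"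
    by (rule hom_exists[where f = c]) (auto simp: real_group_def)
  show ?thesis
  proof
    show "(\<lambda>g. if g \<in> carrier G then h g else 0) \<in> Hom_real G"
      using h(1) by (auto simp: Hom_real_def hom_def real_group_def)
  qed (simp add: h(2))
qed

section \<open>Splitting sets of vertices and the BNS-invariant\<close>

definition supp :: "('a \<Rightarrow> real) \<Rightarrow> 'v set" where
  "supp \<chi> = {v \<in> pverts \<Gamma>. \<chi> (gen v) \<noteq> 0}"

text \<open>
  A nonempty set \<open>L\<close> of vertices splits if and only if the subgraph spanned by \<open>L\<close> is disconnected or not
  dominating; in the latter case \<open>A = L\<close>, and \<open>B\<close> consists of a vertex not dominated by \<open>L\<close>.
\<close>

definition splits :: "'v set \<Rightarrow> bool" where
  "splits L \<longleftrightarrow> (\<exists>A B. A \<noteq> {} \<and> B \<noteq> {} \<and> A \<inter> B = {} \<and> A \<subseteq> L \<and> L \<subseteq> A \<union> B \<and> B \<subseteq> pverts \<Gamma> \<and>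
     (\<forall>v\<in>A. \<forall>w\<in>B. (v, w) \<notin> parcs \<Gamma>))"

lemma splitsE:
  assumes "splits L"
  obtains A B where "A \<noteq> {}" "B \<noteq> {}" "A \<inter> B = {}" "A \<subseteq> L" "L \<subseteq> A \<union> B" "B \<subseteq> pverts \<Gamma>"
    and "\<forall>v\<in>A. \<forall>w\<in>B. (v, w) \<notin> parcs \<Gamma>"
  using assms unfolding splits_def by (elim exE conjE) (rule that)

text \<open>Usually \<open>A\<close> is cut down to \<open>L'\<close>. If nothing of
  \<open>A\<close> remains, then \<open>L'\<close> lies in \<open>B\<close> and the two sides swap
  roles: the old \<open>A\<close> becomes the second set, which may lie outside
  \<open>L'\<close>.\<close>

lemma splits_mono:
  assumes "splits L" "L' \<subseteq> L" "L' \<noteq> {}" "L \<subseteq> pverts \<Gamma>"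
  shows "splits L'"
proof -
  obtain A B where AB: "A \<noteq> {}" "B \<noteq> {}" "A \<inter> B = {}" "A \<subseteq> L" "L \<subseteq> A \<union> B" "B \<subseteq> pverts \<Gamma>"
    and E: "\<forall>v\<in>A. \<forall>w\<in>B. (v, w) \<notin> parcs \<Gamma>"
    using assms(1) by (rule splitsE)
  show ?thesis
  proof (cases "A \<inter> L' = {}")
    case True
    then have "L' \<subseteq> B" using AB assms by blast
    moreover from this have "(v, w) \<notin> parcs \<Gamma>" if "v \<in> L'" "w \<in> A" for v w
      using that E adjacent_sym by blast
    moreover have "A \<subseteq> pverts \<Gamma>" using AB assms by blast
    ultimately show ?thesis unfolding splits_def
      using AB(1) True assms(3) by (intro exI[of _ L'] exI[of _ A]) auto
  next
    case False
    then show ?thesis unfolding splits_def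
      using AB assms(2) E by (intro exI[of _ "A \<inter> L'"] exI[of _ B]) auto
  qed
qed

text \<open>As no edge joins \<open>A\<close> to \<open>B\<close>, the group is an amalgam of the
  subgroups on the vertices outside \<open>B\<close> and outside \<open>A\<close>, over the one on
  the vertices in neither. On the latter \<open>\<chi>\<close> vanishes, so a zero cocycle on the
  first factor glues with a coboundary, or a homomorphism, on the second.\<close>

lemma splits_notin_Sigma1:
  assumes \<chi>: "\<chi> \<in> Hom_real G - {0}" and "splits (supp \<chi>)"
  shows "char_class \<chi> \<notin> Sigma1 G"
proof -
  obtain A B where AB: "A \<noteq> {}" "B \<noteq> {}" "A \<inter> B = {}" "A \<subseteq> supp \<chi>" "supp \<chi> \<subseteq> A \<union> B"
      "B \<subseteq> pverts \<Gamma>"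
    and E: "\<forall>v\<in>A. \<forall>w\<in>B. (v, w) \<notin> parcs \<Gamma>"
    using assms(2) by (rule splitsE)
  have \<chi>H: "\<chi> \<in> Hom_real G" using \<chi> by blast
  have E': "(w, v) \<notin> parcs \<Gamma>" if "v \<in> A" "w \<in> B" for v w
    using E that adjacent_sym by blast
  define \<delta> :: "real \<Rightarrow> real" where "\<delta> x = (if x = 0 then 1 else 0)" for x
  text \<open>
    On \<open>B\<close> the cocycle is the coboundary of \<open>\<delta>\<close>, unless \<open>\<chi>\<close> vanishes there, in which case the
    coboundary would be trivial but \<open>\<delta>\<close> itself is a homomorphism.
  \<close>
  define \<beta> where "\<beta> v = (if v \<notin> B then (\<lambda>x. 0) else if B \<inter> supp \<chi> = {} then \<delta>
      else (\<lambda>x. \<delta> x - \<delta> (x - \<chi> (gen v))))" for v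
  have dead: "\<chi> (gen v) = 0" if "v \<in> pverts \<Gamma>" "v \<notin> A" "v \<notin> B \<or> B \<inter> supp \<chi> = {}" for v
    using that AB unfolding supp_def by blast
  obtain \<theta> where \<theta>: "\<theta> \<in> hom G shift_group"
    and \<theta>_gen: "\<And>v. v \<in> pverts \<Gamma> \<Longrightarrow> \<theta> (gen v) = (\<chi> (gen v), \<beta> v)"
  proof (rule hom_exists[OF group_shift_group])
    show "(\<lambda>v. (\<chi> (gen v), \<beta> v)) \<in> pverts \<Gamma> \<rightarrow> carrier shift_group"
    proof
      fix v
      show "(\<chi> (gen v), \<beta> v) \<in> carrier shift_group"
        unfolding shift_group_simps
        by (rule exI[of _ "min 0 (\<chi> (gen v))"]) (auto simp: \<beta>_def \<delta>_def)
    qed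
    fix v w assume vw: "(v, w) \<in> parcs \<Gamma>"
    then have V: "v \<in> pverts \<Gamma>" "w \<in> pverts \<Gamma>" using \<Gamma>.in_arcsD1 \<Gamma>.in_arcsD2 by auto
    \<comment> \<open>Commutation in \<open>shift_group\<close>. Two vertices of \<open>B\<close>
      carry coboundaries of the same function, or \<open>\<chi>\<close> vanishes at both. If just
      one lies in \<open>B\<close>, the other is outside \<open>A\<close> as well, so its character
      value and its cocycle are zero.\<close>
    have "\<beta> v x + \<beta> w (x - \<chi> (gen v)) = \<beta> w x + \<beta> v (x - \<chi> (gen w))" for x
    proof (cases "v \<in> B")
      case v: True
      show ?thesis
      proof (cases "w \<in> B")
        case True
        then have "v \<notin> A" "w \<notin> A" using v AB(3) by auto
        then show ?thesis using v True dead[OF V(1)] dead[OF V(2)]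
          by (simp add: \<beta>_def algebra_simps)
      next
        case False
        then have "\<chi> (gen w) = 0" using V vw v E' by (intro dead) auto
        then show ?thesis using False by (simp add: \<beta>_def)
      qed
    next
      case v: False
      show ?thesis
      proof (cases "w \<in> B")
        case True
        then have "\<chi> (gen v) = 0" using V vw v E by (intro dead) auto
        then show ?thesis using v by (simp add: \<beta>_def)
      qed (use v in \<open>simp add: \<beta>_def\<close>)
    qed
    then show "(\<chi> (gen v), \<beta> v) \<otimes>\<^bsub>shift_group\<^esub> (\<chi> (gen w), \<beta> w)
        = (\<chi> (gen w), \<beta> w) \<otimes>\<^bsub>shift_group\<^esub> (\<chi> (gen v), \<beta> v)"
      by (auto simp: shift_group_simps)
  qed (rule that)
  interpret shift: group shift_group by (rule group_shift_group)
  interpret \<theta>: group_hom G shift_group \<theta>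
    using \<theta> by unfold_locales
  have inv_shift: "inv\<^bsub>shift_group\<^esub> (r, f) = (- r, \<lambda>x. - f (x + r))"
    if rf: "(r, f) \<in> carrier shift_group" for r f
  proof (rule shift.inv_equality)
    obtain c where "\<forall>x<c. f x = 0" using rf by (auto simp: shift_group_simps)
    then show "(- r, \<lambda>x. - f (x + r)) \<in> carrier shift_group"
      unfolding shift_group_simps by (intro exI[of _ "c - r"]) auto
  qed (use rf in \<open>auto simp: shift_group_simps\<close>)
  have fst_mult: "fst (p \<otimes>\<^bsub>shift_group\<^esub> q) = fst p + fst q" for p q
    by (cases p; cases q) (simp add: shift_group_simps)
  have fst_inv: "fst (inv\<^bsub>shift_group\<^esub> p) = - fst p" if "p \<in> carrier shift_group" for p
    using that by (cases p) (simp add: inv_shift)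
  have gen_carrier: "(\<chi> (gen v), \<beta> v) \<in> carrier shift_group" if "v \<in> pverts \<Gamma>" for v
    using \<theta>.hom_closed[OF gen_closed[OF that]] that by (simp add: \<theta>_gen)
  have fst_\<theta>: "fst (\<theta> g) = \<chi> g" if "g \<in> carrier G" for g
    using that
  proof (induction rule: gen_induct)
    case one
    then show ?case by (simp add: shift_group_simps Hom_real_one[OF \<chi>H])
  qed (simp_all add: fst_mult fst_inv gen_carrier \<theta>_gen Hom_real_mult[OF \<chi>H] Hom_real_inv[OF \<chi>H])
  have snd_inv: "snd (\<theta> (inv (gen v))) = (\<lambda>x. - \<beta> v (x + \<chi> (gen v)))" if "v \<in> pverts \<Gamma>" for v
    using that by (simp add: \<theta>_gen inv_shift gen_carrier)
  obtain a where a: "a \<in> A" using AB by blast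
  then have aV: "a \<in> pverts \<Gamma>" "\<chi> (gen a) \<noteq> 0" "a \<notin> B"
    using AB by (auto simp: supp_def)
  \<comment> \<open>Vertices of \<open>A\<close> are living and carry the zero cocycle; passing to
    the inverse adjusts the sign of the character.\<close>
  obtain t where t: "t \<in> carrier G" "\<chi> t < 0" "snd (\<theta> t) = (\<lambda>x. 0)"
  proof (cases "\<chi> (gen a) < 0")
    case True
    then show ?thesis using that[of "gen a"] aV by (simp add: \<theta>_gen \<beta>_def)
  next
    case False
    then show ?thesis using that[of "inv (gen a)"] aV
      by (simp only: snd_inv) (simp add: \<beta>_def Hom_real_inv[OF \<chi>H])
  qed
  \<comment> \<open>In each case \<open>x0 = 0\<close> works: \<open>\<delta> 0 = 1\<close>, and the
    other term of the coboundary is zero because it sits at a nonzero translate. For negative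
    \<open>\<chi> (gen w)\<close> the inverse of the generator has its cocycle shifted back to
    0.\<close>
  obtain q x0 where q: "q \<in> carrier G" "\<chi> q \<ge> 0" "snd (\<theta> q) x0 \<noteq> 0"
  proof (cases "B \<inter> supp \<chi> = {}")
    case True
    obtain w where w: "w \<in> B" using AB by blast
    then have "w \<in> pverts \<Gamma>" "\<chi> (gen w) = 0" using AB True by (auto simp: supp_def)
    then show ?thesis using that[of "gen w" 0] w True by (simp add: \<theta>_gen \<beta>_def \<delta>_def)
  next
    case False
    then obtain w where w: "w \<in> B" "w \<in> pverts \<Gamma>" "\<chi> (gen w) \<noteq> 0" by (auto simp: supp_def)
    show ?thesis
    proof (cases "\<chi> (gen w) > 0")
      case True
      then show ?thesis using that[of "gen w" 0] w False by (simp add: \<theta>_gen \<beta>_def \<delta>_def)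
    next
      case neg: False
      then show ?thesis using that[of "inv (gen w)" 0] w False
        by (simp only: snd_inv) (simp add: \<beta>_def \<delta>_def Hom_real_inv[OF \<chi>H])
    qed
  qed
  show ?thesis by (rule char_class_notin_Sigma1[OF \<chi> \<theta> fst_\<theta> t q])
qed

text \<open>
  For a living vertex \<open>v\<close> (one with \<open>\<chi> (gen v) \<noteq> 0\<close>), the ray from \<open>g\<close> in the ascending direction of
  \<open>v\<close> eventually lies in one component of the half-space. Commutation squares show that this
  component does not change along edges between living vertices, nor from \<open>g\<close> to \<open>g \<otimes> gen w\<close> if \<open>w\<close> is
  dominated by a living vertex.
\<close>

lemma connected_if_not_splits:
  assumes \<chi>: "\<chi> \<in> Hom_real G" and living: "supp \<chi> \<noteq> {}" and nsplit: "\<not> splits (supp \<chi>)"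
  shows "Digraph_Component.connected
    (Cay G (gen ` pverts \<Gamma>) \<restriction> {g \<in> carrier G. \<chi> g \<ge> 0})"
proof -
  note [simp] = Hom_real_one[OF \<chi>] Hom_real_mult[OF \<chi>] Hom_real_inv[OF \<chi>] Hom_real_pow[OF \<chi>]
  define C where "C = Cay_conn G (gen ` pverts \<Gamma>) {g \<in> carrier G. \<chi> g \<ge> 0}"
  have C_refl: "C g g" if "g \<in> carrier G" "\<chi> g \<ge> 0" for g
    using that unfolding C_def by (intro Cay_conn_refl) auto
  have C_sym: "C h g" if "C g h" for g h
    using that unfolding C_def by (rule Cay_conn_sym)
  have C_trans: "C g k" if "C g h" "C h k" for g h k
    using that unfolding C_def by (rule Cay_conn_trans)
  have C_step: "C g (g \<otimes> gen w)" if "g \<in> carrier G" "w \<in> pverts \<Gamma>" "\<chi> g \<ge> 0" "\<chi> (g \<otimes> gen w) \<ge> 0"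
    for g w using that unfolding C_def by (intro Cay_conn_step) auto

  define up where "up v = (if \<chi> (gen v) > 0 then gen v else inv (gen v))" for v
  have supp_verts: "v \<in> pverts \<Gamma>" if "v \<in> supp \<chi>" for v using that by (simp add: supp_def)
  have up_closed [simp]: "up v \<in> carrier G" if "v \<in> supp \<chi>" for v
    using supp_verts[OF that] by (simp add: up_def)
  have up_pos: "\<chi> (up v) > 0" if "v \<in> supp \<chi>" for v
    using that by (auto simp: up_def supp_def)
  have C_up: "C g (g \<otimes> up v)" if "g \<in> carrier G" "\<chi> g \<ge> 0" "v \<in> supp \<chi>" for g v
  proof (cases "\<chi> (gen v) > 0")
    case True
    then show ?thesis using that supp_verts by (auto simp: up_def intro: C_step)
  next
    case False
    then have "C (g \<otimes> inv (gen v)) (g \<otimes> inv (gen v) \<otimes> gen v)"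
      using that supp_verts by (intro C_step) auto
    then have "C (g \<otimes> up v) g" using that supp_verts False by (simp add: up_def m_assoc)
    then show ?thesis by (rule C_sym)
  qed
  have C_up_pow: "C g (g \<otimes> up v [^] k)" if "g \<in> carrier G" "\<chi> g \<ge> 0" "v \<in> supp \<chi>" for g v and k :: nat
  proof (induction k)
    case 0
    then show ?case using that by (simp add: C_refl)
  next
    case (Suc k)
    have "\<chi> (g \<otimes> up v [^] k) \<ge> 0" using that up_pos[OF that(3)] by simp
    then have "C (g \<otimes> up v [^] k) (g \<otimes> up v [^] k \<otimes> up v)" using that by (intro C_up) auto
    with Suc have "C g (g \<otimes> up v [^] k \<otimes> up v)" by (rule C_trans)
    then show ?case using that by (simp add: m_assoc)
  qed
  \<comment> \<open>The base point may lie below the half-space; by the Archimedean property its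
    ascending ray still enters it and then stays there.\<close>
  have high: "\<exists>N. \<forall>k\<ge>N::nat. \<chi> (g \<otimes> up v [^] k) \<ge> 0" if g: "g \<in> carrier G" and v: "v \<in> supp \<chi>"
    for g v
  proof -
    obtain N :: nat where N: "- \<chi> g < real N * \<chi> (up v)"
      using reals_Archimedean3[OF up_pos[OF v]] by blast
    have "\<chi> (g \<otimes> up v [^] k) \<ge> 0" if "k \<ge> N" for k
    proof -
      have "real N * \<chi> (up v) \<le> real k * \<chi> (up v)"
        using that up_pos[OF v] by (intro mult_right_mono) auto
      then show ?thesis using N g v by simp
    qed
    then show ?thesis by blast
  qed

  \<comment> \<open>\<open>J\<close> compares only the tails of two rays. It is therefore meaningful
    for base points with negative character, which a word leading to an element of the half-space
    may pass through.\<close>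
  define J where
    "J g v h w \<longleftrightarrow> (\<exists>N::nat. \<forall>m\<ge>N. \<forall>k\<ge>N. C (g \<otimes> up v [^] m) (h \<otimes> up w [^] k))"
    for g v h w
  have JI: "J g v h w" if "\<And>m k. m \<ge> N \<Longrightarrow> k \<ge> N \<Longrightarrow> C (g \<otimes> up v [^] m) (h \<otimes> up w [^] k)"
    for g v h w and N :: nat using that unfolding J_def by blast
  have J_sym: "J h w g v" if J: "J g v h w" for g v h w
  proof -
    obtain N :: nat where "\<forall>m\<ge>N. \<forall>k\<ge>N. C (g \<otimes> up v [^] m) (h \<otimes> up w [^] k)"
      using J unfolding J_def by blast
    then show ?thesis by - (rule JI[of N], rule C_sym, simp)
  qed
  have J_trans: "J g v k u" if J1: "J g v h w" and J2: "J h w k u" for g v h w k u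
  proof -
    obtain N1 :: nat where "\<forall>m\<ge>N1. \<forall>k\<ge>N1. C (g \<otimes> up v [^] m) (h \<otimes> up w [^] k)"
      using J1 unfolding J_def by blast
    note 1 = this[rule_format]
    obtain N2 :: nat where "\<forall>m\<ge>N2. \<forall>l\<ge>N2. C (h \<otimes> up w [^] m) (k \<otimes> up u [^] l)"
      using J2 unfolding J_def by blast
    note 2 = this[rule_format]
    show ?thesis
      by (rule JI[of "max N1 N2"], rule C_trans[OF 1[of _ "max N1 N2"] 2]) auto
  qed
  have J_refl: "J g v g v" if g: "g \<in> carrier G" and v: "v \<in> supp \<chi>" for g v
  proof -
    obtain N :: nat where "\<forall>k\<ge>N. \<chi> (g \<otimes> up v [^] k) \<ge> 0" using high[OF g v] by blast
    note N = this[rule_format]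
    have "C (g \<otimes> up v [^] N) (g \<otimes> up v [^] k)" if "k \<ge> N" for k
    proof -
      have "C (g \<otimes> up v [^] N) (g \<otimes> up v [^] N \<otimes> up v [^] (k - N))"
        using g v N by (intro C_up_pow) auto
      then show ?thesis using that g v by (simp add: m_assoc nat_pow_mult)
    qed
    then show ?thesis by (intro JI[of N]) (rule C_trans[OF C_sym])
  qed
  have J_adjacent: "J g v g w"
    if g: "g \<in> carrier G" and v: "v \<in> supp \<chi>" and w: "w \<in> supp \<chi>" and E: "(v, w) \<in> parcs \<Gamma>"
    for g v w
  proof -
    have V: "gen v \<in> carrier G" "gen w \<in> carrier G" using v w supp_verts by auto
    have "gen v \<otimes> gen w = gen w \<otimes> gen v" by (rule gen_commute[OF E])
    then have "up v \<otimes> gen w = gen w \<otimes> up v"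
      using V by (simp add: up_def commute_inv)
    then have "up w \<otimes> up v = up v \<otimes> up w"
      using V v by (simp add: up_def[of w] commute_inv)
    then have comm: "up v [^] m \<otimes> up w [^] k = up w [^] k \<otimes> up v [^] m" for m k :: nat
      using v w by (metis group_commutes_pow nat_pow_closed up_closed)
    obtain N1 :: nat where "\<forall>k\<ge>N1. \<chi> (g \<otimes> up v [^] k) \<ge> 0" using high[OF g v] by blast
    note N1 = this[rule_format]
    obtain N2 :: nat where "\<forall>k\<ge>N2. \<chi> (g \<otimes> up w [^] k) \<ge> 0" using high[OF g w] by blast
    note N2 = this[rule_format]
    show ?thesis
    proof (rule JI[of "max N1 N2"])
      fix m k assume mk: "m \<ge> max N1 N2" "k \<ge> max N1 N2"
      \<comment> \<open>Both rays climb to the common corner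
        \<open>g \<otimes> up v [^] m \<otimes> up w [^] k\<close> of a commuting rectangle, and
        both climbs start inside the half-space.\<close>
      have "C (g \<otimes> up v [^] m) (g \<otimes> up v [^] m \<otimes> up w [^] k)"
        using g v w N1[of m] mk by (intro C_up_pow) auto
      also have "g \<otimes> up v [^] m \<otimes> up w [^] k = g \<otimes> up w [^] k \<otimes> up v [^] m"
        using g v w by (simp add: m_assoc comm)
      finally have "C (g \<otimes> up v [^] m) (g \<otimes> up w [^] k \<otimes> up v [^] m)" .
      moreover have "C (g \<otimes> up w [^] k) (g \<otimes> up w [^] k \<otimes> up v [^] m)"
        using g v w N2[of k] mk by (intro C_up_pow) auto
      ultimately show "C (g \<otimes> up v [^] m) (g \<otimes> up w [^] k)"
        by (rule C_trans[OF _ C_sym])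
    qed
  qed
  obtain v0 where v0: "v0 \<in> supp \<chi>" using living by blast
  have J_base: "J g v0 g w" if g: "g \<in> carrier G" and w: "w \<in> supp \<chi>" for g w
  proof (rule ccontr)
    assume not_J: "\<not> J g v0 g w"
    \<comment> \<open>The living vertices whose rays from \<open>g\<close> share the component of
      the ray along \<open>v0\<close>. No edge leaves this set by \<open>J_adjacent\<close>, so a
      proper such set would split the support.\<close>
    define A where "A = {u \<in> supp \<chi>. J g v0 g u}"
    have "splits (supp \<chi>)" unfolding splits_def
    proof (intro exI conjI ballI)
      show "A \<noteq> {}" using J_refl[OF g v0] v0 by (auto simp: A_def)
      show "supp \<chi> - A \<noteq> {}" using w not_J by (auto simp: A_def)
      fix u u' assume u: "u \<in> A" and u': "u' \<in> supp \<chi> - A"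
      show "(u, u') \<notin> parcs \<Gamma>"
      proof
        assume "(u, u') \<in> parcs \<Gamma>"
        then have "J g u g u'" using u u' by (intro J_adjacent[OF g]) (auto simp: A_def)
        moreover have "J g v0 g u" using u by (simp add: A_def)
        ultimately have "J g v0 g u'" by (rule J_trans[rotated])
        then show False using u' by (auto simp: A_def)
      qed
    qed (auto simp: A_def supp_verts)
    then show False using nsplit by contradiction
  qed
  have dominated: "\<exists>v\<in>supp \<chi>. (v, w) \<in> parcs \<Gamma>" if "w \<in> pverts \<Gamma>" "w \<notin> supp \<chi>" for w
  proof (rule ccontr)
    assume "\<not> ?thesis"
    then have "splits (supp \<chi>)" unfolding splits_def
      using that living by (intro exI[of _ "supp \<chi>"] exI[of _ "{w}"]) auto
    then show False using nsplit by contradiction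
  qed
  have J_shift: "J g v (g \<otimes> up v) v" if g: "g \<in> carrier G" and v: "v \<in> supp \<chi>" for g v
  proof -
    obtain N :: nat where "\<forall>m\<ge>N. \<forall>k\<ge>N. C (g \<otimes> up v [^] m) (g \<otimes> up v [^] k)"
      using J_refl[OF g v] unfolding J_def by blast
    note N = this[rule_format]
    show ?thesis
    proof (rule JI[of N])
      fix m k assume "m \<ge> N" "k \<ge> N"
      then have "C (g \<otimes> up v [^] m) (g \<otimes> up v [^] Suc k)" by (intro N) auto
      then show "C (g \<otimes> up v [^] m) (g \<otimes> up v \<otimes> up v [^] k)"
        using g v nat_pow_Suc2[OF up_closed[OF v], of k] by (simp only: m_assoc up_closed nat_pow_closed)
    qed
  qed
  \<comment> \<open>For living \<open>w\<close>, one of the two rays along \<open>w\<close> is a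
    tail of the other. For \<open>w\<close> outside the support, a living neighbour \<open>v\<close>
    carries the edge from \<open>g\<close> up its ray, where the edge stays at constant
    height.\<close>
  have J_gen_exists: "\<exists>v\<in>supp \<chi>. J g v (g \<otimes> gen w) v"
    if g: "g \<in> carrier G" and w: "w \<in> pverts \<Gamma>" for g w
  proof (cases "w \<in> supp \<chi>")
    case True
    have "J g w (g \<otimes> gen w) w"
    proof (cases "\<chi> (gen w) > 0")
      case pos: True
      then show ?thesis using J_shift[OF g True] by (simp add: up_def)
    next
      case False
      then have "J (g \<otimes> gen w) w (g \<otimes> gen w \<otimes> inv (gen w)) w"
        using J_shift[of "g \<otimes> gen w" w] g w True by (simp add: up_def)
      then have "J (g \<otimes> gen w) w g w" using g w by (simp add: m_assoc)
      then show ?thesis by (rule J_sym)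
    qed
    then show ?thesis using True by blast
  next
    case False
    then obtain v where v: "v \<in> supp \<chi>" and E: "(v, w) \<in> parcs \<Gamma>" using dominated w by blast
    have dead: "\<chi> (gen w) = 0" using False w by (simp add: supp_def)
    have "up v \<otimes> gen w = gen w \<otimes> up v"
      using gen_commute[OF E] v w supp_verts by (simp add: up_def commute_inv)
    then have comm: "up v [^] k \<otimes> gen w = gen w \<otimes> up v [^] k" for k :: nat
      using v w by (simp add: group_commutes_pow)
    obtain N1 :: nat where "\<forall>k\<ge>N1. \<chi> (g \<otimes> up v [^] k) \<ge> 0" using high[OF g v] by blast
    note N1 = this[rule_format]
    obtain N2 :: nat where "\<forall>m\<ge>N2. \<forall>k\<ge>N2. C (g \<otimes> up v [^] m) (g \<otimes> up v [^] k)"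
      using J_refl[OF g v] unfolding J_def by blast
    note N2 = this[rule_format]
    have "J g v (g \<otimes> gen w) v"
    proof (rule JI[of "max N1 N2"])
      fix m k assume mk: "m \<ge> max N1 N2" "k \<ge> max N1 N2"
      have "C (g \<otimes> up v [^] m) (g \<otimes> up v [^] k)" using mk by (intro N2) auto
      moreover have "C (g \<otimes> up v [^] k) (g \<otimes> up v [^] k \<otimes> gen w)"
        using g v w N1[of k] mk dead by (intro C_step) auto
      ultimately have "C (g \<otimes> up v [^] m) (g \<otimes> up v [^] k \<otimes> gen w)" by (rule C_trans)
      also have "g \<otimes> up v [^] k \<otimes> gen w = g \<otimes> gen w \<otimes> up v [^] k"
        using g v w by (simp add: m_assoc comm)
      finally show "C (g \<otimes> up v [^] m) (g \<otimes> gen w \<otimes> up v [^] k)" .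
    qed
    then show ?thesis using v by blast
  qed
  have J_gen: "J g v0 (g \<otimes> gen w) v0" if g: "g \<in> carrier G" and w: "w \<in> pverts \<Gamma>" for g w
  proof -
    obtain v where v: "v \<in> supp \<chi>" "J g v (g \<otimes> gen w) v" using J_gen_exists[OF g w] by blast
    have "J (g \<otimes> gen w) v (g \<otimes> gen w) v0" using g w v by (intro J_sym[OF J_base]) auto
    then show ?thesis by (rule J_trans[OF J_trans[OF J_base[OF g v(1)] v(2)]])
  qed
  have J_all: "J \<one> v0 g v0" if "g \<in> carrier G" for g
    using that
  proof (induction rule: gen_induct)
    case one
    then show ?case using v0 by (simp add: J_refl)
  next
    case (gen h w)
    then show ?case by (intro J_trans[of _ _ h, OF _ J_gen])
  next
    case (inv_gen h w)
    then have "J (h \<otimes> inv (gen w)) v0 (h \<otimes> inv (gen w) \<otimes> gen w) v0" by (intro J_gen) auto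
    then have "J (h \<otimes> inv (gen w)) v0 h v0" using inv_gen by (simp add: m_assoc)
    then have "J h v0 (h \<otimes> inv (gen w)) v0" by (rule J_sym)
    then show ?case by (rule J_trans[OF inv_gen.IH])
  qed
  have C_one: "C \<one> g" if g: "g \<in> carrier G" "\<chi> g \<ge> 0" for g
  proof -
    \<comment> \<open>Here both base points lie in the half-space, so their whole rays do, and each
      point is connected to its own tail.\<close>
    obtain N :: nat where N: "C (\<one> \<otimes> up v0 [^] N) (g \<otimes> up v0 [^] N)"
      using J_all[OF g(1)] unfolding J_def by blast
    have "C \<one> (\<one> \<otimes> up v0 [^] N)" using v0 by (intro C_up_pow) auto
    moreover have "C (g \<otimes> up v0 [^] N) g" using v0 g by (intro C_sym[OF C_up_pow])
    ultimately show ?thesis by (rule C_trans[OF C_trans[OF _ N]])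
  qed
  show ?thesis unfolding connected_Cay_restrict_iff C_def[symmetric]
  proof (intro conjI ballI)
    have "\<one> \<in> {g \<in> carrier G. \<chi> g \<ge> 0}" by simp
    then show "{g \<in> carrier G. \<chi> g \<ge> 0} \<noteq> {}" by blast
  next
    fix g h assume "g \<in> {g \<in> carrier G. \<chi> g \<ge> 0}" "h \<in> {g \<in> carrier G. \<chi> g \<ge> 0}"
    then show "C g h" by (intro C_trans[OF C_sym[OF C_one] C_one]) auto
  qed
qed

section \<open>Maximal missing subspaces of a right-angled Artin group\<close>

lemma supp_nonempty: "\<chi> \<in> Hom_real G - {0} \<Longrightarrow> supp \<chi> \<noteq> {}"
  using Hom_real_ext[of \<chi> 0] subspace_0[OF subspace_Hom_real[OF is_group]]
  by (auto simp: supp_def)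

text \<open>The Meier-VanWyk criterion: a character belongs to the invariant if and only if its
  living vertices span a connected and dominating subgraph.\<close>

lemma Sigma1_iff_not_splits:
  assumes \<chi>: "\<chi> \<in> Hom_real G - {0}"
  shows "char_class \<chi> \<in> Sigma1 G \<longleftrightarrow> \<not> splits (supp \<chi>)"
proof
  show "\<not> splits (supp \<chi>)" if "char_class \<chi> \<in> Sigma1 G"
    using splits_notin_Sigma1[OF \<chi>] that by blast
  show "char_class \<chi> \<in> Sigma1 G" if "\<not> splits (supp \<chi>)"
    unfolding char_class_in_Sigma1_iff[OF \<chi>]
    using finite_generating_set_gen connected_if_not_splits[OF _ supp_nonempty[OF \<chi>] that] \<chi>
    by (intro exI conjI) auto
qed

text \<open>A generic combination of two characters has the union of their supports as support, so a
  support of maximal cardinality contains every other.\<close>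

lemma subspace_max_supp:
  assumes W: "subspace W"
  obtains \<chi> where "\<chi> \<in> W" and "\<And>\<psi>. \<psi> \<in> W \<Longrightarrow> supp \<psi> \<subseteq> supp \<chi>"
proof -
  have fin: "finite (supp \<chi>)" for \<chi>
    using \<Gamma>.pair_finite_verts by (simp add: supp_def)
  have "card (supp \<chi>) \<le> card (pverts \<Gamma>)" for \<chi>
    using \<Gamma>.pair_finite_verts by (intro card_mono) (auto simp: supp_def)
  then have "\<exists>\<chi>. \<chi> \<in> W \<and> (\<forall>\<psi>. \<psi> \<in> W \<longrightarrow> card (supp \<psi>) \<le> card (supp \<chi>))"
    using subspace_0[OF W] by (intro ex_has_greatest_nat) (auto intro: le_imp_less_Suc)
  then obtain \<chi> where \<chi>: "\<chi> \<in> W" and max: "\<And>\<psi>. \<psi> \<in> W \<Longrightarrow> card (supp \<psi>) \<le> card (supp \<chi>)"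
    by auto
  have "supp \<psi> \<subseteq> supp \<chi>" if \<psi>: "\<psi> \<in> W" for \<psi>
  proof -
    have "finite ((\<lambda>v. - \<chi> (gen v) / \<psi> (gen v)) ` pverts \<Gamma>)"
      using \<Gamma>.pair_finite_verts by simp
    \<comment> \<open>The finitely many ratios excluded are those at which the combination could
      cancel. Where \<open>\<psi> (gen v) = 0\<close>, division by zero yields 0, so only
      \<open>c = 0\<close> is excluded on its account.\<close>
    then obtain c :: real where c: "c \<notin> (\<lambda>v. - \<chi> (gen v) / \<psi> (gen v)) ` pverts \<Gamma>"
      using ex_new_if_finite infinite_UNIV_char_0 by metis
    have "supp \<chi> \<union> supp \<psi> \<subseteq> supp (\<chi> + c *\<^sub>R \<psi>)"
    proof
      fix v assume v: "v \<in> supp \<chi> \<union> supp \<psi>"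
      then have vV: "v \<in> pverts \<Gamma>" by (auto simp: supp_def)
      have "\<chi> (gen v) + c * \<psi> (gen v) \<noteq> 0"
      proof (cases "\<psi> (gen v) = 0")
        case True
        then show ?thesis using v by (auto simp: supp_def)
      next
        case False
        then have "c \<noteq> - \<chi> (gen v) / \<psi> (gen v)" using c vV by blast
        then show ?thesis using False by (auto simp: field_simps)
      qed
      then show "v \<in> supp (\<chi> + c *\<^sub>R \<psi>)" using vV by (simp add: supp_def scaleR_fun_def)
    qed
    moreover have "card (supp (\<chi> + c *\<^sub>R \<psi>)) \<le> card (supp \<chi>)"
      using W \<chi> \<psi> by (intro max subspace_add subspace_scale)
    ultimately have "supp \<chi> = supp (\<chi> + c *\<^sub>R \<psi>)"
      by (intro card_seteq fin) auto
    then show ?thesis using \<open>supp \<chi> \<union> supp \<psi> \<subseteq> supp (\<chi> + c *\<^sub>R \<psi>)\<close> by blast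
  qed
  then show ?thesis using \<chi> that by blast
qed

lemma maximal_missing_subspace_coordinate:
  assumes "maximal_missing_subspace G W"
  obtains Z where "Z \<subseteq> pverts \<Gamma>" and "W = {\<chi> \<in> Hom_real G. \<forall>v\<in>Z. \<chi> (gen v) = 0}"
proof -
  have W: "subspace W" "W \<subseteq> Hom_real G"
    and miss: "\<And>\<chi>. \<chi> \<in> W - {0} \<Longrightarrow> char_class \<chi> \<notin> Sigma1 G"
    and max: "\<And>W'. missing_subspace G W' \<Longrightarrow> W \<subseteq> W' \<Longrightarrow> W' = W"
    using assms unfolding maximal_missing_subspace_def missing_subspace_def by auto
  obtain \<chi> where \<chi>: "\<chi> \<in> W" and gen: "\<And>\<psi>. \<psi> \<in> W \<Longrightarrow> supp \<psi> \<subseteq> supp \<chi>"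
    using subspace_max_supp[OF W(1)] by blast
  define W' where "W' = {\<psi> \<in> Hom_real G. \<forall>v\<in>pverts \<Gamma> - supp \<chi>. \<psi> (gen v) = 0}"
  have supp_W': "supp \<psi> \<subseteq> supp \<chi>" if "\<psi> \<in> W'" for \<psi>
    using that by (auto simp: W'_def supp_def)
  have "W \<subseteq> W'" using W gen by (fastforce simp: W'_def supp_def)
  have "missing_subspace G W'" unfolding missing_subspace_def
  proof (intro conjI ballI)
    have H: "subspace (Hom_real G)" by (rule subspace_Hom_real[OF is_group])
    show "subspace W'"
      using subspace_0[OF H] subspace_add[OF H] subspace_scale[OF H]
      by (intro subspaceI) (auto simp: W'_def scaleR_fun_def)
    show "W' \<subseteq> Hom_real G" by (auto simp: W'_def)
    fix \<psi> assume \<psi>: "\<psi> \<in> W' - {0}"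
    then have \<psi>H: "\<psi> \<in> Hom_real G - {0}" by (auto simp: W'_def)
    \<comment> \<open>The assumption on \<open>W\<close> concerns nonzero characters only; that
      \<open>\<chi>\<close> is one of them follows from the nonempty support of
      \<open>\<psi>\<close> inside its own.\<close>
    have "supp \<psi> \<noteq> {}" by (rule supp_nonempty[OF \<psi>H])
    moreover have "supp \<psi> \<subseteq> supp \<chi>" using \<psi> supp_W' by blast
    moreover have "supp 0 = {}" by (simp add: supp_def)
    ultimately have "\<chi> \<in> W - {0}" using \<chi> by auto
    then have "splits (supp \<chi>)" using miss W Sigma1_iff_not_splits by blast
    then have "splits (supp \<psi>)"
      by (rule splits_mono) (use \<open>supp \<psi> \<noteq> {}\<close> \<open>supp \<psi> \<subseteq> supp \<chi>\<close> in \<open>auto simp: supp_def\<close>)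
    then show "char_class \<psi> \<notin> Sigma1 G" using Sigma1_iff_not_splits[OF \<psi>H] by blast
  qed
  then have "W = W'" using max \<open>W \<subseteq> W'\<close> by blast
  then show ?thesis using that[of "pverts \<Gamma> - supp \<chi>"] unfolding W'_def by blast
qed

end

section \<open>Coordinate subspaces are never redundant\<close>

context
  fixes V :: "'v::real_vector set" and ip :: "'v \<Rightarrow> 'v \<Rightarrow> real"
  assumes ip: "inner_product_on V ip" and V: "subspace V"
begin

lemma ip_commute: "u \<in> V \<Longrightarrow> v \<in> V \<Longrightarrow> ip u v = ip v u"
  and ip_add: "u \<in> V \<Longrightarrow> v \<in> V \<Longrightarrow> w \<in> V \<Longrightarrow> ip (u + v) w = ip u w + ip v w"
  and ip_scaleR: "u \<in> V \<Longrightarrow> w \<in> V \<Longrightarrow> ip (c *\<^sub>R u) w = c * ip u w"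
  using ip by (auto simp: inner_product_on_def)

lemma ip_zero: "w \<in> V \<Longrightarrow> ip 0 w = 0"
  using ip_scaleR[of 0 w 0] subspace_0[OF V] by simp

lemma ip_sum:
  assumes "\<And>i. i \<in> I \<Longrightarrow> f i \<in> V" "w \<in> V"
  shows "ip (\<Sum>i\<in>I. c i *\<^sub>R f i) w = (\<Sum>i\<in>I. c i * ip (f i) w)"
  using assms
  by (induction I rule: infinite_finite_induct)
    (simp_all add: ip_zero ip_add ip_scaleR subspace_sum[OF V] subspace_scale[OF V])

lemma ip_diff: "u \<in> V \<Longrightarrow> v \<in> V \<Longrightarrow> w \<in> V \<Longrightarrow> ip (u - v) w = ip u w - ip v w"
  using ip_add[of "u - v" v w] by (simp add: subspace_diff[OF V])

lemma subspace_perp_in: "W \<subseteq> V \<Longrightarrow> subspace (perp_in V ip W)"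
  using V by (intro subspaceI)
    (auto simp: perp_in_def subset_eq ip_zero ip_add ip_scaleR
      subspace_0 subspace_add subspace_scale)

lemma orthonormal_basis_expansion:
  assumes e: "orthonormal_basis_on V ip n e" and u: "u \<in> V"
  shows "(\<Sum>i=1..n. ip u (e i) *\<^sub>R e i) = u"
    and "j \<in> {1..n} \<Longrightarrow> coord n e j u = ip u (e j)"
proof -
  have inj: "inj_on e {1..n}" and ind: "independent (e ` {1..n})" and span: "span (e ` {1..n}) = V"
    and ortho: "\<And>i j. i \<in> {1..n} \<Longrightarrow> j \<in> {1..n} \<Longrightarrow> ip (e i) (e j) = (if i = j then 1 else 0)"
    using e unfolding orthonormal_basis_on_def by auto
  have eV: "e i \<in> V" if "i \<in> {1..n}" for i
    using span that span_base[of "e i" "e ` {1..n}"] by blast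
  have "(\<Sum>b\<in>e ` {1..n}. representation (e ` {1..n}) u b *\<^sub>R b) = u"
    using ind u span by (intro real_vector.sum_representation_eq) auto
  then have sum: "(\<Sum>i=1..n. coord n e i u *\<^sub>R e i) = u"
    by (simp only: sum.reindex[OF inj] o_def coord_def)
  have coord: "coord n e j u = ip u (e j)" if j: "j \<in> {1..n}" for j
  proof -
    have "ip (\<Sum>i=1..n. coord n e i u *\<^sub>R e i) (e j) = (\<Sum>i=1..n. coord n e i u * ip (e i) (e j))"
      using eV j by (intro ip_sum) auto
    also have "\<dots> = (\<Sum>i=1..n. if i = j then coord n e i u else 0)"
      using ortho j by (intro sum.cong) auto
    also have "\<dots> = coord n e j u" using j by simp
    finally show ?thesis by (simp only: sum)
  qed
  then show "j \<in> {1..n} \<Longrightarrow> coord n e j u = ip u (e j)" .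
  show "(\<Sum>i=1..n. ip u (e i) *\<^sub>R e i) = u"
  proof -
    have "(\<Sum>i=1..n. ip u (e i) *\<^sub>R e i) = (\<Sum>i=1..n. coord n e i u *\<^sub>R e i)"
      using coord by (intro sum.cong) auto
    then show ?thesis by (simp only: sum)
  qed
qed

text \<open>
  The vectors \<open>r i\<close> represent the coordinate functionals with respect to the basis \<open>d\<close>. The
  orthogonal complement of a coordinate subspace is spanned by some of the \<open>r i\<close>, so \<open>\<xi>\<close> can be
  decomposed separately along each \<open>r i\<close>.
\<close>

lemma coordinate_subspaces_not_redundant:
  assumes I: "finite I"
    and rV: "\<And>i. i \<in> I \<Longrightarrow> r i \<in> V" and dV: "\<And>i. i \<in> I \<Longrightarrow> d i \<in> V"
    and dual: "\<And>i j. i \<in> I \<Longrightarrow> j \<in> I \<Longrightarrow> ip (d i) (r j) = (if i = j then 1 else 0)"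
    and expand: "\<And>u. u \<in> V \<Longrightarrow> u = (\<Sum>i\<in>I. ip u (d i) *\<^sub>R r i)"
    and Z: "Z1 \<subseteq> I" "Z2 \<subseteq> I" "Z3 \<subseteq> I"
    and W1: "W1 = {w \<in> V. \<forall>i\<in>Z1. ip w (r i) = 0}"
    and W2: "W2 = {w \<in> V. \<forall>i\<in>Z2. ip w (r i) = 0}"
    and W3: "W3 = {w \<in> V. \<forall>i\<in>Z3. ip w (r i) = 0}"
  shows "\<not> redundant_triple V ip n e W1 W2 W3"
proof
  assume red: "redundant_triple V ip n e W1 W2 W3"
  define P1 P2 P3 where P: "P1 = perp_in V ip W1" "P2 = perp_in V ip W2" "P3 = perp_in V ip W3"
  have n: "1 \<in> {1..n}" "2 \<in> {1..n}" and e: "orthonormal_basis_on V ip n e"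
    and cut: "cut_out_with V n e (coord n e 1) W1" "cut_out_with V n e (coord n e 2) W2"
      "cut_out_with V n e (\<lambda>v. coord n e 1 v - coord n e 2 v) W3"
    using red unfolding redundant_triple_def by auto
  have indecomposable: False
    if "a \<in> P1 \<inter> P2" "b \<in> P2 \<inter> P3" "c \<in> P1 \<inter> P3"
      "(- e 1, e 2, e 1 - e 2) = (a, - a, 0) + (0, b, - b) + (c, 0, - c)" for a b c
  proof -
    let ?K = "{a + b + c | a b c. a \<in> {(u, - u, 0) | u. u \<in> P1 \<inter> P2} \<and>
        b \<in> {(0, u, - u) | u. u \<in> P2 \<inter> P3} \<and> c \<in> {(u, 0, - u) | u. u \<in> P1 \<inter> P3}}"
    have "(- e 1, e 2, e 1 - e 2) \<notin> ?K"
      using red unfolding redundant_triple_def Let_def P by (elim conjE)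
    moreover have "(- e 1, e 2, e 1 - e 2) \<in> ?K"
      using that
      by (intro CollectI exI[of _ "(a, - a, 0)"] exI[of _ "(0, b, - b)"] exI[of _ "(c, 0, - c)"] conjI)
        auto
    ultimately show False by contradiction
  qed
  have "e i \<in> V" if "i \<in> {1..n}" for i
    using e that span_base[of "e i" "e ` {1..n}"] unfolding orthonormal_basis_on_def by blast
  then have eV: "e 1 \<in> V" "e 2 \<in> V" using n by auto
  have sub: "subspace P1" "subspace P2" "subspace P3"
    using W1 W2 W3 unfolding P by (auto intro!: subspace_perp_in)
  have coord_ip: "coord n e 1 w = ip (e 1) w" "coord n e 2 w = ip (e 2) w" if "w \<in> V" for w
    using orthonormal_basis_expansion(2)[OF e that] n ip_commute[OF that] eV by auto
  have "coord n e 1 w = 0" if "w \<in> W1" for w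
    using cut(1) that unfolding cut_out_with_def by blast
  moreover have "coord n e 2 w = 0" if "w \<in> W2" for w
    using cut(2) that unfolding cut_out_with_def by blast
  moreover have "coord n e 1 w - coord n e 2 w = 0" if "w \<in> W3" for w
    using cut(3) that unfolding cut_out_with_def by blast
  ultimately have e_perp: "e 1 \<in> P1" "e 2 \<in> P2" "e 1 - e 2 \<in> P3"
    using eV subspace_diff[OF V eV] unfolding P perp_in_def
    by (simp_all add: W1 W2 W3 ip_diff del: One_nat_def flip: coord_ip)
  have r_perp: "i \<in> Z1 \<Longrightarrow> r i \<in> P1" "i \<in> Z2 \<Longrightarrow> r i \<in> P2" "i \<in> Z3 \<Longrightarrow> r i \<in> P3" for i
    using Z rV ip_commute by (auto simp: P perp_in_def W1 W2 W3 subset_eq)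
  define c where "c u i = ip u (d i)" for u i
  \<comment> \<open>For \<open>i\<close> outside \<open>Z1\<close> the dual vector
    \<open>d i\<close> lies in \<open>W1\<close>, so pairing it with an element of \<open>P1\<close>
    gives zero; likewise for the other two.\<close>
  have c_zero: "u \<in> P1 \<Longrightarrow> i \<notin> Z1 \<Longrightarrow> c u i = 0" "u \<in> P2 \<Longrightarrow> i \<notin> Z2 \<Longrightarrow> c u i = 0"
    "u \<in> P3 \<Longrightarrow> i \<notin> Z3 \<Longrightarrow> c u i = 0" if i: "i \<in> I" for u i
  proof -
    have "d i \<in> W1" if "i \<notin> Z1" using that i Z dV by (auto simp: W1 dual subset_eq)
    then show "u \<in> P1 \<Longrightarrow> i \<notin> Z1 \<Longrightarrow> c u i = 0" by (auto simp: P perp_in_def c_def)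
    have "d i \<in> W2" if "i \<notin> Z2" using that i Z dV by (auto simp: W2 dual subset_eq)
    then show "u \<in> P2 \<Longrightarrow> i \<notin> Z2 \<Longrightarrow> c u i = 0" by (auto simp: P perp_in_def c_def)
    have "d i \<in> W3" if "i \<notin> Z3" using that i Z dV by (auto simp: W3 dual subset_eq)
    then show "u \<in> P3 \<Longrightarrow> i \<notin> Z3 \<Longrightarrow> c u i = 0" by (auto simp: P perp_in_def c_def)
  qed
  have c_diff: "c (e 1 - e 2) i = c (e 1) i - c (e 2) i" if "i \<in> I" for i
    using that eV dV by (simp add: c_def ip_diff)
  \<comment> \<open>Since \<open>e 1 - e 2\<close> lies in \<open>P3\<close>, it has no coefficient
    outside \<open>Z3\<close>.\<close>
  have c_eq: "c (e 1) i = c (e 2) i" if "i \<in> I - Z3" for i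
    using c_zero(3)[OF _ e_perp(3), of i] c_diff[of i] that by simp
  define s where "s u J = (\<Sum>i\<in>J. c u i *\<^sub>R r i)" for u J
  have split: "u = s u (I - Z3) + s u Z3" if "u \<in> V" for u
    using expand[OF that] sum.subset_diff[OF Z(3) I, of "\<lambda>i. c u i *\<^sub>R r i"]
    by (simp add: s_def c_def)
  have s_perp: "s u J \<in> P" if "subspace P" "\<And>i. i \<in> J \<Longrightarrow> c u i \<noteq> 0 \<Longrightarrow> r i \<in> P" for P u J
    unfolding s_def
  proof (rule subspace_sum[OF that(1)])
    fix i assume "i \<in> J"
    then show "c u i *\<^sub>R r i \<in> P"
      using that(2)[of i] subspace_scale[OF that(1)] subspace_0[OF that(1)] by (cases "c u i = 0") auto
  qed
  have 1: "s (e 1) (I - Z3) = s (e 2) (I - Z3)"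
    unfolding s_def using c_eq by (intro sum.cong) auto
  \<comment> \<open>Write \<open>e 1 = A + B\<close> and \<open>e 2 = A + C\<close>, where
    \<open>A\<close> is the shared part off \<open>Z3\<close>. Then \<open>A\<close> lies in
    \<open>P1 \<inter> P2\<close>, \<open>B\<close> in \<open>P1 \<inter> P3\<close> and
    \<open>C\<close> in \<open>P2 \<inter> P3\<close>, and the vector to be decomposed is
    \<open>(- A, A, 0) + (0, C, - C) + (- B, 0, B)\<close>.\<close>
  have "s (e 1) (I - Z3) \<in> P1" "s (e 1) Z3 \<in> P1" "s (e 1) Z3 \<in> P3"
    using Z c_zero(1)[OF _ e_perp(1)] r_perp by (intro s_perp sub; fastforce)+
  moreover have "s (e 2) (I - Z3) \<in> P2" "s (e 2) Z3 \<in> P2" "s (e 2) Z3 \<in> P3"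
    using Z c_zero(2)[OF _ e_perp(2)] r_perp by (intro s_perp sub; fastforce)+
  ultimately have "- s (e 1) (I - Z3) \<in> P1 \<inter> P2" "s (e 2) Z3 \<in> P2 \<inter> P3" "- s (e 1) Z3 \<in> P1 \<inter> P3"
    using 1 sub by (auto intro: subspace_neg)
  then show False
  proof (rule indecomposable)
    show "(- e 1, e 2, e 1 - e 2) = (- s (e 1) (I - Z3), - (- s (e 1) (I - Z3)), 0) +
        (0, s (e 2) Z3, - s (e 2) Z3) + (- s (e 1) Z3, 0, - (- s (e 1) Z3))"
    proof -
      have "(- x, y, x - y) = (- A, - (- A), 0) + (0, C, - C) + (- B, 0, - (- B))"
        if "x = A + B" "y = A + C" for x y A B C :: 'v
        using that by simp
      then show ?thesis using split[OF eV(1)] split[OF eV(2), folded 1] .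
    qed
  qed
qed

end

section \<open>Vertex evaluations as vectors in the space of characters\<close>

lemma sum_fun_apply: "(\<Sum>i\<in>I. f i) x = (\<Sum>i\<in>I. f i x)"
  by (induction I rule: infinite_finite_induct) auto

theorem proposition4p36:
  fixes G :: "('a, 'b) monoid_scheme"
    and W1 W2 W3 :: "('a \<Rightarrow> real) set"
    and ip :: "('a \<Rightarrow> real) \<Rightarrow> ('a \<Rightarrow> real) \<Rightarrow> real"
    and n :: nat and e :: "nat \<Rightarrow> 'a \<Rightarrow> real"
  assumes "group G"
    and "finitely_generated G"
    and "maximal_missing_subspace G W1"
    and "maximal_missing_subspace G W2"
    and "maximal_missing_subspace G W3"
    and "redundant_triple (Hom_real G) ip n e W1 W2 W3"
  shows "\<not> (\<exists>\<Gamma> :: 'v pair_pre_digraph. pair_graph \<Gamma> \<and> G \<cong> raag \<Gamma>)"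
proof
  assume "\<exists>\<Gamma> :: 'v pair_pre_digraph. pair_graph \<Gamma> \<and> G \<cong> raag \<Gamma>"
  then obtain \<Gamma> :: "'v pair_pre_digraph" and \<phi> where \<Gamma>: "pair_graph \<Gamma>" and \<phi>: "\<phi> \<in> iso G (raag \<Gamma>)"
    by (auto simp: is_iso_def)
  interpret group G by (rule assms(1))
  interpret \<Gamma>: pair_graph \<Gamma> by (rule \<Gamma>)
  interpret raag_iso G \<Gamma> \<phi> by unfold_locales (rule \<phi>)
  let ?V = "Hom_real G"
  have V: "subspace ?V" by (rule subspace_Hom_real[OF assms(1)])
  have ip: "inner_product_on ?V ip" and e: "orthonormal_basis_on ?V ip n e"
    using assms(6) by (auto simp: redundant_triple_def)
  have eV: "e i \<in> ?V" if "i \<in> {1..n}" for i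
    using e that span_base[of "e i" "e ` {1..n}"] unfolding orthonormal_basis_on_def by blast
  note ip_sum = ip_sum[OF ip V] and ip_commute = ip_commute[OF ip V]
    and expansion = orthonormal_basis_expansion(1)[OF ip V e]
  \<comment> \<open>The characters \<open>d v\<close> form the basis dual to the evaluations at the
    vertex generators.\<close>
  have "\<exists>\<chi>. \<chi> \<in> ?V \<and> (\<forall>w\<in>pverts \<Gamma>. \<chi> (gen w) = (if v = w then 1 else 0))" for v
    by (rule Hom_real_exists[of "\<lambda>w. if v = w then 1 else 0"]) blast
  then obtain d where dV: "\<And>v. d v \<in> ?V"
    and d_gen: "\<And>v w. w \<in> pverts \<Gamma> \<Longrightarrow> d v (gen w) = (if v = w then 1 else 0)"
    by metis
  \<comment> \<open>The Riesz vector of evaluation at \<open>gen v\<close>: its coefficient along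
    \<open>e i\<close> has to be the value of that functional at \<open>e i\<close>.\<close>
  define r where "r v = (\<Sum>i=1..n. e i (gen v) *\<^sub>R e i)" for v
  have rV: "r v \<in> ?V" for v
    unfolding r_def using eV by (intro subspace_sum[OF V] subspace_scale[OF V])
  have ip_r: "ip \<chi> (r v) = \<chi> (gen v)" if \<chi>: "\<chi> \<in> ?V" for \<chi> v
  proof -
    have "ip \<chi> (r v) = (\<Sum>i=1..n. e i (gen v) * ip (e i) \<chi>)"
      unfolding ip_commute[OF \<chi> rV] unfolding r_def using eV \<chi> by (intro ip_sum)
    also have "\<dots> = (\<Sum>i=1..n. ip \<chi> (e i) *\<^sub>R e i) (gen v)"
      using eV \<chi> by (auto simp: sum_fun_apply scaleR_fun_def ip_commute intro!: sum.cong)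
    finally show ?thesis by (simp only: expansion[OF \<chi>])
  qed
  have char_expand: "\<chi> = (\<Sum>v\<in>pverts \<Gamma>. \<chi> (gen v) *\<^sub>R d v)" if \<chi>: "\<chi> \<in> ?V" for \<chi>
  proof (rule Hom_real_ext[OF \<chi>])
    show "(\<Sum>v\<in>pverts \<Gamma>. \<chi> (gen v) *\<^sub>R d v) \<in> ?V"
      using dV by (intro subspace_sum[OF V] subspace_scale[OF V])
    fix w assume w: "w \<in> pverts \<Gamma>"
    have "(\<Sum>v\<in>pverts \<Gamma>. \<chi> (gen v) *\<^sub>R d v) (gen w) = (\<Sum>v\<in>pverts \<Gamma>. if v = w then \<chi> (gen v) else 0)"
      unfolding sum_fun_apply by (intro sum.cong) (simp_all add: scaleR_fun_def d_gen w)
    also have "\<dots> = \<chi> (gen w)" using w \<Gamma>.pair_finite_verts by simp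
    finally show "\<chi> (gen w) = (\<Sum>v\<in>pverts \<Gamma>. \<chi> (gen v) *\<^sub>R d v) (gen w)" by (simp only:)
  qed
  have expand: "u = (\<Sum>v\<in>pverts \<Gamma>. ip u (d v) *\<^sub>R r v)" if u: "u \<in> ?V" for u
  proof -
    \<comment> \<open>The matrix \<open>e i (gen v)\<close> both expands \<open>e i\<close> over
      \<open>d\<close> and defines \<open>r v\<close> over \<open>e\<close>. Exchanging the two sums
      thus turns the orthonormal expansion of \<open>u\<close> into one over
      \<open>r\<close>.\<close>
    have ip_e: "ip u (e i) = (\<Sum>v\<in>pverts \<Gamma>. e i (gen v) * ip u (d v))" if i: "i \<in> {1..n}" for i
    proof -
      have "ip u (e i) = ip (\<Sum>v\<in>pverts \<Gamma>. e i (gen v) *\<^sub>R d v) u"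
        using ip_commute[OF u eV[OF i]] char_expand[OF eV[OF i]] by simp
      also have "\<dots> = (\<Sum>v\<in>pverts \<Gamma>. e i (gen v) * ip (d v) u)"
        using dV u by (intro ip_sum)
      finally show ?thesis using ip_commute[OF u dV] by simp
    qed
    have "u = (\<Sum>i=1..n. ip u (e i) *\<^sub>R e i)" by (simp only: expansion[OF u])
    also have "\<dots> = (\<Sum>i=1..n. \<Sum>v\<in>pverts \<Gamma>. ip u (d v) *\<^sub>R e i (gen v) *\<^sub>R e i)"
      by (intro sum.cong) (auto simp: ip_e scaleR_sum_left mult.commute)
    also have "\<dots> = (\<Sum>v\<in>pverts \<Gamma>. ip u (d v) *\<^sub>R r v)"
      unfolding r_def by (subst sum.swap) (simp add: scaleR_sum_right)
    finally show ?thesis .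
  qed
  have coordinate: "\<exists>Z\<subseteq>pverts \<Gamma>. W = {w \<in> ?V. \<forall>v\<in>Z. ip w (r v) = 0}"
    if W: "maximal_missing_subspace G W" for W
    by (rule maximal_missing_subspace_coordinate[OF W]) (auto simp: ip_r cong: conj_cong)
  from coordinate[OF assms(3)] obtain Z1 where
    1: "Z1 \<subseteq> pverts \<Gamma>" "W1 = {w \<in> ?V. \<forall>v\<in>Z1. ip w (r v) = 0}" by (elim exE conjE)
  from coordinate[OF assms(4)] obtain Z2 where
    2: "Z2 \<subseteq> pverts \<Gamma>" "W2 = {w \<in> ?V. \<forall>v\<in>Z2. ip w (r v) = 0}" by (elim exE conjE)
  from coordinate[OF assms(5)] obtain Z3 where
    3: "Z3 \<subseteq> pverts \<Gamma>" "W3 = {w \<in> ?V. \<forall>v\<in>Z3. ip w (r v) = 0}" by (elim exE conjE)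
  have "\<not> redundant_triple ?V ip n e W1 W2 W3"
    by (rule coordinate_subspaces_not_redundant[OF ip V \<Gamma>.pair_finite_verts rV dV _ expand 1(1) 2(1) 3(1) 1(2) 2(2) 3(2)])
      (simp_all add: ip_r dV d_gen)
  then show False using assms(6) by contradiction
qed

end
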